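(* For each integer $N\ge 1$ let $(J_{ij})_{1\le i,j\le N}$ be i.i.d. standard Gaussian random variables, let $$H(\eta)=\frac{1}{\sqrt N}\sum_{i,j=1}^N J_{ij}\eta_i\eta_j,\qquad \eta\in\{0,1\}^N,$$ let $M=\min_{\eta\in\{0,1\}^N}H(\eta)$ and $\Delta=M-E(M)$. Then there exists a constant $C>0$, independent of $N$ and $z$, such that for all $N\ge 1$ and all $z>0$ $$P(|\Delta|>Nz)\le e^{-CNz^2}.$$
   Context: The sum defining $H$ runs over all ordered pairs $(i,j)\in\{1,\dots,N\}^2$, including the diagonal terms $i=j$; the $N^2$ variables $J_{ij}$ are mutually independent Gaussians with mean $0$ and variance $1$ (no symmetry $J_{ij}=J_{ji}$ is imposed). $P$ and $E$ denote probability and expectation with respect to the $J_{ij}$. *)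

theory Defs
  imports "HOL-Probability.Probability"
begin

definition iid_std_gaussians :: "nat \<Rightarrow> 'a measure \<Rightarrow> (nat \<Rightarrow> nat \<Rightarrow> 'a \<Rightarrow> real) \<Rightarrow> bool" where
  "iid_std_gaussians N \<Omega> J \<longleftrightarrow>
     prob_space \<Omega> \<and>
     prob_space.indep_vars \<Omega> (\<lambda>_. borel) (\<lambda>(i, j). J i j) ({1..N} \<times> {1..N}) \<and>
     (\<forall>i\<in>{1..N}. \<forall>j\<in>{1..N}. distributed \<Omega> lborel (J i j) std_normal_density)"

definition configs :: "nat \<Rightarrow> (nat \<Rightarrow> real) set" where
  "configs N = {1..N} \<rightarrow>\<^sub>E {0, 1}"

definition hamiltonian :: "nat \<Rightarrow> (nat \<Rightarrow> nat \<Rightarrow> real) \<Rightarrow> (nat \<Rightarrow> real) \<Rightarrow> real" where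
  "hamiltonian N J \<eta> = 1 / sqrt (real N) * (\<Sum>i=1..N. \<Sum>j=1..N. J i j * \<eta> i * \<eta> j)"

definition ground_energy :: "nat \<Rightarrow> (nat \<Rightarrow> nat \<Rightarrow> 'a \<Rightarrow> real) \<Rightarrow> 'a \<Rightarrow> real" where
  "ground_energy N J \<omega> = Min (hamiltonian N (\<lambda>i j. J i j \<omega>) ` configs N)"

definition ground_deviation :: "nat \<Rightarrow> 'a measure \<Rightarrow> (nat \<Rightarrow> nat \<Rightarrow> 'a \<Rightarrow> real) \<Rightarrow> 'a \<Rightarrow> real" where
  "ground_deviation N \<Omega> J \<omega> =
     ground_energy N J \<omega> - integral\<^sup>L \<Omega> (ground_energy N J)"

end

theory Submission
  imports Defs
begin

text \<open>
  The rescaled ground energy \<open>f = M / \<surd>N\<close> is a minimum of linear forms of norm at most 1 in the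
  couplings.  Rotating an independent copy of the couplings into the original one in \<open>n\<close> small steps
  (a discrete version of the Maurey-Pisier argument, in which concavity of \<open>f\<close> replaces
  differentiability) gives \<open>P(|f - E f| > t) \<le> 2 exp (-t\<^sup>2/8)\<close>.

  The factor 2 is harmful only for small \<open>t\<close>, where \<open>P(|f - E f| \<le> t) \<ge> c t\<close> is needed uniformly
  in \<open>N\<close>.  The same rotation applied to a clipped version of \<open>f\<close> bounds \<open>P(|f - E f| \<le> t)\<close> from below
  by a multiple of \<open>t P(f - E f \<ge> t/2) P(f - E f \<le> -t/2)\<close>, so it remains to see that the fluctuations
  of \<open>f\<close> do not degenerate.  With probability at least 1/10 some minimizer occupies at least \<open>N/6\<close>
  sites, because otherwise some small \<open>T\<close> has \<open>N - |T|\<close> independent symmetric local fields of the same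
  sign.  Then lowering all couplings by \<open>1/N\<close>, a shift of norm 1 that changes Gaussian probabilities in
  a controlled way only, lowers \<open>f\<close> by at least 1/36.
\<close>

section \<open>Gaussian product measures\<close>

text \<open>At \<open>t = sqrt N * z\<close> the claim reads
  \<open>P(|dev| > t) \<le> exp (- C * t\<^sup>2)\<close>. The right side is below 1 for every
  positive \<open>t\<close>, so near 0 the law of \<open>dev\<close> must put mass close to its
  mean, at a rate that does not depend on \<open>N\<close>. Concavity can replace differentiability
  because only upward increments are ever estimated: a minimizer \<open>a\<close> at
  \<open>x\<close> is a competitor at the rotated point, and since \<open>a\<close> does not depend
  on the independent copy \<open>y\<close>, \<open>lin a y\<close> is a centred Gaussian of variance
  at most 1 once \<open>x\<close> is fixed. Each step has a fluctuation of order
  \<open>1 / n\<close> and a drift of order \<open>1 / n\<^sup>2\<close>, so the drifts vanish as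
  \<open>n\<close> grows. Clipping localizes the path: a short step that starts far from the mean
  does not raise the clipped value, so only the time spent near the mean counts. A lower bound on
  the fluctuations is false for general families of forms of norm 1 (the minimum of many independent
  coordinates has vanishing variance). What helps here is that all weights are nonnegative: one
  common shift of the couplings lowers the energy of every large set.\<close>

definition std_gauss :: "real measure" where
  "std_gauss = density lborel std_normal_density"

lemma sets_std_gauss [simp, measurable_cong]: "sets std_gauss = sets borel"
  by (simp add: std_gauss_def)

lemma space_std_gauss [simp]: "space std_gauss = UNIV"
  by (simp add: std_gauss_def)

lemma prob_space_std_gauss: "prob_space std_gauss"
  unfolding std_gauss_def by (rule prob_space_normal_density) simp

interpretation std_gauss: prob_space std_gauss
  by (rule prob_space_std_gauss)

lemma nn_integral_std_gauss:
  assumes [measurable]: "f \<in> borel_measurable borel"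
  shows "(\<integral>\<^sup>+x. f x \<partial>std_gauss) = (\<integral>\<^sup>+x. ennreal (std_normal_density x) * f x \<partial>lborel)"
  unfolding std_gauss_def by (subst nn_integral_density) auto

lemma std_gauss_shift:
  fixes v :: real
  assumes [measurable]: "f \<in> borel_measurable borel"
  shows "(\<integral>\<^sup>+x. f (x + v) \<partial>std_gauss) = (\<integral>\<^sup>+x. ennreal (exp (v * x - v\<^sup>2 / 2)) * f x \<partial>std_gauss)"
proof -
  have "(\<integral>\<^sup>+x. f (x + v) \<partial>std_gauss) = (\<integral>\<^sup>+x. ennreal (std_normal_density x) * f (x + v) \<partial>lborel)"
    by (rule nn_integral_std_gauss) measurable
  also have "\<dots> = (\<integral>\<^sup>+x. ennreal (std_normal_density (x - v)) * f x \<partial>lborel)"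
    by (subst nn_integral_real_affine[where c = 1 and t = "-v"]) (auto simp: algebra_simps)
  also have "\<dots> = (\<integral>\<^sup>+x. ennreal (std_normal_density x) * (ennreal (exp (v * x - v\<^sup>2 / 2)) * f x) \<partial>lborel)"
  proof (rule nn_integral_cong)
    fix x
    have "std_normal_density (x - v) = std_normal_density x * exp (v * x - v\<^sup>2 / 2)"
      by (simp add: std_normal_density_def exp_add[symmetric] power2_eq_square field_simps)
    then show "ennreal (std_normal_density (x - v)) * f x =
        ennreal (std_normal_density x) * (ennreal (exp (v * x - v\<^sup>2 / 2)) * f x)"
      by (simp add: ennreal_mult' mult.assoc)
  qed
  also have "\<dots> = (\<integral>\<^sup>+x. ennreal (exp (v * x - v\<^sup>2 / 2)) * f x \<partial>std_gauss)"
    by (rule nn_integral_std_gauss[symmetric]) measurable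
  finally show ?thesis .
qed

text \<open>The shift identity applied to the constant function
  \<open>exp (v\<^sup>2 / 2)\<close>.\<close>

lemma std_gauss_mgf: "(\<integral>\<^sup>+x. ennreal (exp (v * x)) \<partial>std_gauss) = ennreal (exp (v\<^sup>2 / 2))"
proof -
  have "(\<integral>\<^sup>+x. ennreal (exp (v * x)) \<partial>std_gauss)
      = (\<integral>\<^sup>+x. ennreal (exp (v * x - v\<^sup>2 / 2)) * ennreal (exp (v\<^sup>2 / 2)) \<partial>std_gauss)"
    by (simp add: ennreal_mult'[symmetric] exp_add[symmetric])
  also have "\<dots> = (\<integral>\<^sup>+x. (\<lambda>x. ennreal (exp (v\<^sup>2 / 2))) (x + v) \<partial>std_gauss)"
    by (rule std_gauss_shift[symmetric]) simp
  finally show ?thesis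
    using std_gauss.emeasure_space_1 by simp
qed

lemma std_gauss_uminus: "distr std_gauss std_gauss uminus = std_gauss"
proof (rule measure_eqI)
  fix A assume "A \<in> sets (distr std_gauss std_gauss uminus)"
  then have [measurable]: "A \<in> sets borel" by simp
  have "emeasure (distr std_gauss std_gauss uminus) A = (\<integral>\<^sup>+x. indicator A (- x) \<partial>std_gauss)"
    by (subst nn_integral_indicator[symmetric], simp, subst nn_integral_distr) auto
  also have "\<dots> = (\<integral>\<^sup>+x. ennreal (std_normal_density x) * indicator A (- x) \<partial>lborel)"
    by (rule nn_integral_std_gauss) measurable
  also have "\<dots> = (\<integral>\<^sup>+x. ennreal (std_normal_density x) * indicator A x \<partial>lborel)"
    by (subst nn_integral_real_affine[where c = "-1" and t = 0])
       (auto simp: std_normal_density_def)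
  also have "\<dots> = (\<integral>\<^sup>+x. indicator A x \<partial>std_gauss)"
    by (rule nn_integral_std_gauss[symmetric]) measurable
  finally show "emeasure (distr std_gauss std_gauss uminus) A = emeasure std_gauss A"
    by simp
qed simp

text \<open>Fubini splits the rotation into two one-dimensional affine substitutions, in
  \<open>x\<close> with \<open>y\<close> fixed and then in \<open>y\<close> with \<open>x\<close>
  fixed. Their Jacobians \<open>1 / c\<close> and \<open>c\<close> cancel, and the exponent
  \<open>x\<^sup>2 + y\<^sup>2\<close> is invariant. The first substitution divides by
  \<open>c\<close>.\<close>

lemma std_gauss_pair_rotation:
  fixes c s :: real
  assumes cs: "c\<^sup>2 + s\<^sup>2 = 1" and c0: "c \<noteq> 0"
  shows "distr (std_gauss \<Otimes>\<^sub>M std_gauss) (borel \<Otimes>\<^sub>M borel) (\<lambda>(x, y). (c * x + s * y, c * y - s * x))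
    = std_gauss \<Otimes>\<^sub>M std_gauss"
proof (rule measure_eqI)
  let ?P = "std_gauss \<Otimes>\<^sub>M std_gauss" and ?\<phi> = std_normal_density
  let ?T = "\<lambda>(x, y). (c * x + s * y, c * y - s * x)"
  interpret P: pair_prob_space std_gauss std_gauss ..
  fix A assume "A \<in> sets (distr ?P (borel \<Otimes>\<^sub>M borel) ?T)"
  then have [measurable]: "A \<in> sets (borel \<Otimes>\<^sub>M borel)" by simp
  let ?F = "\<lambda>x y. ennreal (?\<phi> (c * x - s * y)) * (ennreal (?\<phi> (c * y + s * x)) * indicator A (x, y))"
  have "emeasure (distr ?P (borel \<Otimes>\<^sub>M borel) ?T) A = (\<integral>\<^sup>+z. indicator A (?T z) \<partial>?P)"
    by (subst nn_integral_indicator[symmetric], simp, subst nn_integral_distr) auto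
  also have "\<dots> = (\<integral>\<^sup>+y. \<integral>\<^sup>+x. indicator A (c * x + s * y, c * y - s * x) \<partial>std_gauss \<partial>std_gauss)"
    by (subst P.nn_integral_snd[symmetric]) (auto intro!: nn_integral_cong)
  also have "\<dots> = (\<integral>\<^sup>+y. ennreal (?\<phi> y) * (\<integral>\<^sup>+x. ennreal (?\<phi> x) * indicator A (c * x + s * y, c * y - s * x) \<partial>lborel) \<partial>lborel)"
    by (subst nn_integral_std_gauss, measurable,
        intro nn_integral_cong arg_cong2[where f = "(*)"] refl nn_integral_std_gauss) measurable
  also have "\<dots> = (\<integral>\<^sup>+y. ennreal (?\<phi> y) * (ennreal \<bar>1 / c\<bar> * (\<integral>\<^sup>+x. ennreal (?\<phi> ((x - s * y) / c)) * indicator A (x, (y - s * x) / c) \<partial>lborel)) \<partial>lborel)"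
  proof (intro nn_integral_cong arg_cong2[where f = "(*)"] refl)
    fix y
    have e: "c * (c * y) = y - s * (s * y)"
      using arg_cong[OF cs, of "\<lambda>u. u * y"] by (simp add: power2_eq_square algebra_simps)
    have "(\<integral>\<^sup>+x. ennreal (?\<phi> x) * indicator A (c * x + s * y, c * y - s * x) \<partial>lborel)
        = ennreal \<bar>1 / c\<bar> * (\<integral>\<^sup>+x. ennreal (?\<phi> (- s * y / c + 1 / c * x)) *
            indicator A (c * (- s * y / c + 1 / c * x) + s * y, c * y - s * (- s * y / c + 1 / c * x)) \<partial>lborel)"
      using c0 by (subst nn_integral_real_affine[where c = "1 / c" and t = "- s * y / c"]) auto
    also have "\<dots> = ennreal \<bar>1 / c\<bar> * (\<integral>\<^sup>+x. ennreal (?\<phi> ((x - s * y) / c)) * indicator A (x, (y - s * x) / c) \<partial>lborel)"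
    proof (intro nn_integral_cong arg_cong2[where f = "(*)"] refl)
      fix x
      have 1: "- s * y / c + 1 / c * x = (x - s * y) / c"
        by (simp add: diff_divide_distrib)
      have 2: "c * ((x - s * y) / c) + s * y = x"
        using c0 by simp
      have 3: "c * y - s * ((x - s * y) / c) = (y - s * x) / c"
        using c0 e by (simp add: field_simps)
      show "ennreal (?\<phi> (- s * y / c + 1 / c * x)) = ennreal (?\<phi> ((x - s * y) / c))"
        by (simp only: 1)
      show "indicator A (c * (- s * y / c + 1 / c * x) + s * y, c * y - s * (- s * y / c + 1 / c * x))
          = (indicator A (x, (y - s * x) / c) :: ennreal)"
        by (simp only: 1 2 3)
    qed
    finally show "(\<integral>\<^sup>+x. ennreal (?\<phi> x) * indicator A (c * x + s * y, c * y - s * x) \<partial>lborel)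
        = ennreal \<bar>1 / c\<bar> * (\<integral>\<^sup>+x. ennreal (?\<phi> ((x - s * y) / c)) * indicator A (x, (y - s * x) / c) \<partial>lborel)" .
  qed
  also have "\<dots> = (\<integral>\<^sup>+y. \<integral>\<^sup>+x. ennreal \<bar>1 / c\<bar> * (ennreal (?\<phi> y) * (ennreal (?\<phi> ((x - s * y) / c)) * indicator A (x, (y - s * x) / c))) \<partial>lborel \<partial>lborel)"
    by (intro nn_integral_cong) (simp add: nn_integral_cmult ac_simps)
  also have "\<dots> = (\<integral>\<^sup>+x. \<integral>\<^sup>+y. ennreal \<bar>1 / c\<bar> * (ennreal (?\<phi> y) * (ennreal (?\<phi> ((x - s * y) / c)) * indicator A (x, (y - s * x) / c))) \<partial>lborel \<partial>lborel)"
    by (rule lborel_pair.Fubini') measurable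
  also have "\<dots> = (\<integral>\<^sup>+x. \<integral>\<^sup>+y. ennreal (?\<phi> y) * (ennreal (?\<phi> x) * indicator A (x, y)) \<partial>lborel \<partial>lborel)"
  proof (rule nn_integral_cong)
    fix x
    have ee: "s * (s * x) = x - c * (c * x)"
      using arg_cong[OF cs, of "\<lambda>u. u * x"] by (simp add: power2_eq_square algebra_simps)
    have "(\<integral>\<^sup>+y. ennreal \<bar>1 / c\<bar> * (ennreal (?\<phi> y) * (ennreal (?\<phi> ((x - s * y) / c)) * indicator A (x, (y - s * x) / c))) \<partial>lborel)
      = ennreal \<bar>c\<bar> * (\<integral>\<^sup>+y. ennreal \<bar>1 / c\<bar> * (ennreal (?\<phi> (s * x + c * y)) * (ennreal (?\<phi> ((x - s * (s * x + c * y)) / c)) * indicator A (x, ((s * x + c * y) - s * x) / c))) \<partial>lborel)"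
      using c0 by (subst nn_integral_real_affine[where c = "c" and t = "s * x"]) auto
    also have "\<dots> = (\<integral>\<^sup>+y. ennreal \<bar>c\<bar> * (ennreal \<bar>1 / c\<bar> * (ennreal (?\<phi> (s * x + c * y)) * (ennreal (?\<phi> ((x - s * (s * x + c * y)) / c)) * indicator A (x, ((s * x + c * y) - s * x) / c)))) \<partial>lborel)"
      by (rule nn_integral_cmult[symmetric]) measurable
    also have "\<dots> = (\<integral>\<^sup>+y. ennreal (?\<phi> y) * (ennreal (?\<phi> x) * indicator A (x, y)) \<partial>lborel)"
    proof (rule nn_integral_cong)
      fix y
      have 1: "ennreal \<bar>c\<bar> * ennreal \<bar>1 / c\<bar> = 1"
        using c0 by (simp add: ennreal_mult'[symmetric] abs_mult[symmetric])
      have 2: "(x - s * (s * x + c * y)) / c = c * x - s * y"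
        using c0 ee by (simp add: field_simps)
      have 3: "((s * x + c * y) - s * x) / c = y"
        using c0 by simp
      have "(s * x + c * y)\<^sup>2 + (c * x - s * y)\<^sup>2 = (c\<^sup>2 + s\<^sup>2) * (x\<^sup>2 + y\<^sup>2)"
        by (simp add: power2_eq_square algebra_simps)
      then have q: "(s * x + c * y)\<^sup>2 + (c * x - s * y)\<^sup>2 = x\<^sup>2 + y\<^sup>2" using cs by simp
      have q': "- (s * x + c * y)\<^sup>2 / 2 + - (c * x - s * y)\<^sup>2 / 2 = - y\<^sup>2 / 2 + - x\<^sup>2 / 2"
        using q by (simp add: field_simps)
      have "?\<phi> (s * x + c * y) * ?\<phi> (c * x - s * y) = ?\<phi> y * ?\<phi> x"
        unfolding std_normal_density_def
        using arg_cong[OF q', of exp] unfolding exp_add by (simp add: field_simps)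
      then have 4: "ennreal (?\<phi> (s * x + c * y)) * ennreal (?\<phi> (c * x - s * y)) = ennreal (?\<phi> y) * ennreal (?\<phi> x)"
        by (simp add: ennreal_mult'[symmetric])
      show "ennreal \<bar>c\<bar> * (ennreal \<bar>1 / c\<bar> * (ennreal (?\<phi> (s * x + c * y)) * (ennreal (?\<phi> ((x - s * (s * x + c * y)) / c)) * indicator A (x, ((s * x + c * y) - s * x) / c))))
         = ennreal (?\<phi> y) * (ennreal (?\<phi> x) * indicator A (x, y))"
        unfolding 2 3 by (simp only: mult.assoc[symmetric] 1 4 mult_1)
    qed
    finally show "(\<integral>\<^sup>+y. ennreal \<bar>1 / c\<bar> * (ennreal (?\<phi> y) * (ennreal (?\<phi> ((x - s * y) / c)) * indicator A (x, (y - s * x) / c))) \<partial>lborel)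
      = (\<integral>\<^sup>+y. ennreal (?\<phi> y) * (ennreal (?\<phi> x) * indicator A (x, y)) \<partial>lborel)" .
  qed
  also have "\<dots> = (\<integral>\<^sup>+x. \<integral>\<^sup>+y. ennreal (?\<phi> x) * indicator A (x, y) \<partial>std_gauss \<partial>lborel)"
    by (intro nn_integral_cong nn_integral_std_gauss[symmetric]) measurable
  also have "\<dots> = (\<integral>\<^sup>+x. ennreal (?\<phi> x) * (\<integral>\<^sup>+y. indicator A (x, y) \<partial>std_gauss) \<partial>lborel)"
    by (intro nn_integral_cong nn_integral_cmult) measurable
  also have "\<dots> = (\<integral>\<^sup>+x. \<integral>\<^sup>+y. indicator A (x, y) \<partial>std_gauss \<partial>std_gauss)"
    by (rule nn_integral_std_gauss[symmetric]) measurable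
  also have "\<dots> = emeasure ?P A"
    by (subst std_gauss.nn_integral_fst) auto
  finally show "emeasure (distr ?P (borel \<Otimes>\<^sub>M borel) ?T) A = emeasure ?P A" .
qed (simp cong: sets_pair_measure_cong)

section \<open>Finite Gaussian products: sign flips, shifts, exponential moments\<close>

definition gauss :: "'i set \<Rightarrow> ('i \<Rightarrow> real) measure" where
  "gauss I = (\<Pi>\<^sub>M i\<in>I. std_gauss)"

interpretation std_gauss_prod: product_prob_space "\<lambda>_. std_gauss" I for I :: "'i set"
  by unfold_locales

lemma sets_gauss [simp, measurable_cong]: "sets (gauss I) = sets (\<Pi>\<^sub>M i\<in>I. borel)"
  unfolding gauss_def by (intro sets_PiM_cong) auto

lemma space_gauss [simp]: "space (gauss I) = (\<Pi>\<^sub>E i\<in>I. UNIV)"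
  unfolding gauss_def by (simp add: space_PiM)

lemma prob_space_gauss: "prob_space (gauss I)"
  unfolding gauss_def by (intro prob_space_PiM prob_space_std_gauss)

lemma gauss_flip:
  fixes \<sigma> :: "'i \<Rightarrow> real"
  assumes I: "finite I" and \<sigma>: "\<And>i. i \<in> I \<Longrightarrow> \<sigma> i = 1 \<or> \<sigma> i = -1"
  shows "distr (gauss I) (gauss I) (\<lambda>x. \<lambda>i\<in>I. \<sigma> i * x i) = gauss I"
  unfolding gauss_def
proof (rule std_gauss_prod.PiM_eqI[OF I])
  let ?G = "\<Pi>\<^sub>M i\<in>I. std_gauss"
  fix A :: "'i \<Rightarrow> real set" assume A: "\<And>i. i \<in> I \<Longrightarrow> A i \<in> sets std_gauss"
  have m: "(\<lambda>x. \<lambda>i\<in>I. \<sigma> i * x i) \<in> measurable ?G ?G"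
    by measurable
  have flip: "emeasure std_gauss ((\<lambda>t. \<sigma> i * t) -` A i) = emeasure std_gauss (A i)" if "i \<in> I" for i
  proof (cases "\<sigma> i = 1")
    case False
    then have "\<sigma> i = -1" using \<sigma> that by auto
    then have "emeasure std_gauss ((\<lambda>t. \<sigma> i * t) -` A i) = emeasure (distr std_gauss std_gauss uminus) (A i)"
      using A[OF that] by (subst emeasure_distr) (auto simp: vimage_def)
    then show ?thesis unfolding std_gauss_uminus .
  qed auto
  have "emeasure (distr ?G ?G (\<lambda>x. \<lambda>i\<in>I. \<sigma> i * x i)) (Pi\<^sub>E I A)
      = emeasure ?G ((\<lambda>x. \<lambda>i\<in>I. \<sigma> i * x i) -` Pi\<^sub>E I A \<inter> space ?G)"
    using A I by (intro emeasure_distr m sets_PiM_I_finite) auto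
  also have "(\<lambda>x. \<lambda>i\<in>I. \<sigma> i * x i) -` Pi\<^sub>E I A \<inter> space ?G = (\<Pi>\<^sub>E i\<in>I. (\<lambda>t. \<sigma> i * t) -` A i)"
    by (auto simp: space_PiM PiE_iff)
  also have "emeasure ?G \<dots> = (\<Prod>i\<in>I. emeasure std_gauss ((\<lambda>t. \<sigma> i * t) -` A i))"
    using A I measurable_sets_borel[of "\<lambda>t. \<sigma> _ * t" borel]
    by (intro std_gauss_prod.emeasure_PiM) auto
  also have "\<dots> = (\<Prod>i\<in>I. emeasure std_gauss (A i))"
    by (intro prod.cong refl flip)
  finally show "emeasure (distr ?G ?G (\<lambda>x. \<lambda>i\<in>I. \<sigma> i * x i)) (Pi\<^sub>E I A) = (\<Prod>i\<in>I. emeasure std_gauss (A i))" .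
qed simp

text \<open>The Cameron-Martin formula in finite dimension. The translated measure and the weighted
  measure agree on boxes with the product of the shifted one-dimensional laws \<open>R\<close>,
  hence with each other.\<close>

lemma gauss_shift:
  fixes v :: "'i \<Rightarrow> real"
  assumes I: "finite I" and f: "f \<in> borel_measurable (gauss I)"
  shows "(\<integral>\<^sup>+x. f (\<lambda>i\<in>I. x i + v i) \<partial>gauss I)
    = (\<integral>\<^sup>+x. ennreal (\<Prod>i\<in>I. exp (v i * x i - (v i)\<^sup>2 / 2)) * f x \<partial>gauss I)"
proof -
  let ?G = "\<Pi>\<^sub>M i\<in>I. std_gauss" and ?S = "\<lambda>x. \<lambda>i\<in>I. x i + v i"
  let ?w = "\<lambda>x. ennreal (\<Prod>i\<in>I. exp (v i * x i - (v i)\<^sup>2 / 2))"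
  define R where "R i = distr std_gauss std_gauss (\<lambda>t. t + v i)" for i
  have R: "prob_space (R i)" for i
    unfolding R_def by (rule std_gauss.prob_space_distr) simp
  interpret R: product_prob_space R I
    by (rule product_prob_spaceI) (rule R)
  have sets_R: "sets (PiM I R) = sets ?G"
    by (intro sets_PiM_cong) (auto simp: R_def)
  have em_R: "emeasure (R i) (A i) = emeasure std_gauss ((\<lambda>t. t + v i) -` A i)"
    if "A i \<in> sets (R i)" for A :: "'i \<Rightarrow> real set" and i
    using that unfolding R_def by (subst emeasure_distr) auto
  have m: "?S \<in> measurable ?G ?G"
    by measurable
  have "distr ?G ?G ?S = PiM I R"
  proof (rule R.PiM_eqI[OF I])
    fix A :: "'i \<Rightarrow> real set" assume A: "\<And>i. i \<in> I \<Longrightarrow> A i \<in> sets (R i)"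
    then have A': "A i \<in> sets borel" if "i \<in> I" for i using that by (auto simp: R_def)
    have "emeasure (distr ?G ?G ?S) (Pi\<^sub>E I A) = emeasure ?G (?S -` Pi\<^sub>E I A \<inter> space ?G)"
      using A' I by (intro emeasure_distr m sets_PiM_I_finite) auto
    also have "?S -` Pi\<^sub>E I A \<inter> space ?G = (\<Pi>\<^sub>E i\<in>I. (\<lambda>t. t + v i) -` A i)"
      by (auto simp: space_PiM PiE_iff)
    also have "emeasure ?G \<dots> = (\<Prod>i\<in>I. emeasure std_gauss ((\<lambda>t. t + v i) -` A i))"
      using A' I measurable_sets_borel[of "\<lambda>t. t + v _" borel]
      by (intro std_gauss_prod.emeasure_PiM) auto
    also have "\<dots> = (\<Prod>i\<in>I. emeasure (R i) (A i))"
      using A em_R by (intro prod.cong) auto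
    finally show "emeasure (distr ?G ?G ?S) (Pi\<^sub>E I A) = (\<Prod>i\<in>I. emeasure (R i) (A i))" .
  qed (simp add: sets_R)
  moreover have "density ?G ?w = PiM I R"
  proof (rule R.PiM_eqI[OF I])
    fix A :: "'i \<Rightarrow> real set" assume A: "\<And>i. i \<in> I \<Longrightarrow> A i \<in> sets (R i)"
    then have A'[measurable]: "i \<in> I \<Longrightarrow> A i \<in> sets borel" for i by (auto simp: R_def)
    have "emeasure (density ?G ?w) (Pi\<^sub>E I A) = (\<integral>\<^sup>+x. ?w x * indicator (Pi\<^sub>E I A) x \<partial>?G)"
      using A' I by (intro emeasure_density sets_PiM_I_finite) auto
    also have "\<dots> = (\<integral>\<^sup>+x. (\<Prod>i\<in>I. ennreal (exp (v i * x i - (v i)\<^sup>2 / 2)) * indicator (A i) (x i)) \<partial>?G)"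
    proof (rule nn_integral_cong)
      fix x assume x: "x \<in> space ?G"
      then have "indicator (Pi\<^sub>E I A) x = (\<Prod>i\<in>I. indicator (A i) (x i) :: ennreal)"
        using I by (auto simp: indicator_def space_PiM PiE_iff)
      then show "?w x * indicator (Pi\<^sub>E I A) x
          = (\<Prod>i\<in>I. ennreal (exp (v i * x i - (v i)\<^sup>2 / 2)) * indicator (A i) (x i))"
        by (simp add: prod.distrib prod_ennreal)
    qed
    also have "\<dots> = (\<Prod>i\<in>I. \<integral>\<^sup>+t. ennreal (exp (v i * t - (v i)\<^sup>2 / 2)) * indicator (A i) t \<partial>std_gauss)"
      by (rule std_gauss_prod.product_nn_integral_prod[OF I]) measurable
    also have "\<dots> = (\<Prod>i\<in>I. emeasure (R i) (A i))"
    proof (rule prod.cong[OF refl])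
      fix i assume i: "i \<in> I"
      have "(\<integral>\<^sup>+t. ennreal (exp (v i * t - (v i)\<^sup>2 / 2)) * indicator (A i) t \<partial>std_gauss)
          = (\<integral>\<^sup>+t. indicator (A i) (t + v i) \<partial>std_gauss)"
        using A'[OF i] by (subst std_gauss_shift) auto
      also have "\<dots> = (\<integral>\<^sup>+t. indicator ((\<lambda>t. t + v i) -` A i) t \<partial>std_gauss)"
        by (intro nn_integral_cong) (simp add: indicator_def)
      also have "\<dots> = emeasure std_gauss ((\<lambda>t. t + v i) -` A i)"
        using A'[OF i] measurable_sets_borel[of "\<lambda>t. t + v i" borel]
        by (intro nn_integral_indicator) auto
      finally show "(\<integral>\<^sup>+t. ennreal (exp (v i * t - (v i)\<^sup>2 / 2)) * indicator (A i) t \<partial>std_gauss) = emeasure (R i) (A i)"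
        using em_R[of A i, OF A[OF i]] by simp
    qed
    finally show "emeasure (density ?G ?w) (Pi\<^sub>E I A) = (\<Prod>i\<in>I. emeasure (R i) (A i))" .
  qed (simp add: sets_R)
  ultimately have eq: "distr ?G ?G ?S = density ?G ?w" by simp
  have f': "f \<in> borel_measurable ?G" using f by (simp add: gauss_def)
  have "(\<integral>\<^sup>+x. f (?S x) \<partial>?G) = (\<integral>\<^sup>+x. f x \<partial>distr ?G ?G ?S)"
    using f' m by (subst nn_integral_distr) auto
  also have "\<dots> = (\<integral>\<^sup>+x. ?w x * f x \<partial>?G)"
    unfolding eq using f' by (subst nn_integral_density) auto
  finally show ?thesis unfolding gauss_def .
qed

lemma gauss_mgf:
  fixes a :: "'i \<Rightarrow> real"
  assumes I: "finite I"
  shows "(\<integral>\<^sup>+x. ennreal (exp (l * (\<Sum>i\<in>I. a i * x i))) \<partial>gauss I) = ennreal (exp (l\<^sup>2 * (\<Sum>i\<in>I. (a i)\<^sup>2) / 2))"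
proof -
  have "(\<integral>\<^sup>+x. ennreal (exp (l * (\<Sum>i\<in>I. a i * x i))) \<partial>gauss I)
      = (\<integral>\<^sup>+x. (\<Prod>i\<in>I. ennreal (exp ((l * a i) * x i))) \<partial>gauss I)"
    using I by (simp add: exp_sum sum_distrib_left mult.assoc prod_ennreal)
  also have "\<dots> = (\<Prod>i\<in>I. \<integral>\<^sup>+t. ennreal (exp ((l * a i) * t)) \<partial>std_gauss)"
    unfolding gauss_def by (rule std_gauss_prod.product_nn_integral_prod[OF I]) measurable
  also have "\<dots> = ennreal (exp (l\<^sup>2 * (\<Sum>i\<in>I. (a i)\<^sup>2) / 2))"
    using I by (simp add: std_gauss_mgf prod_ennreal exp_sum[symmetric] sum_distrib_left sum_divide_distrib power_mult_distrib)
  finally show ?thesis .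
qed

section \<open>Rotation of two independent copies\<close>

definition lin_comb :: "'i set \<Rightarrow> real \<Rightarrow> real \<Rightarrow> ('i \<Rightarrow> real) \<Rightarrow> ('i \<Rightarrow> real) \<Rightarrow> 'i \<Rightarrow> real" where
  "lin_comb I c s x y = (\<lambda>i\<in>I. c * x i + s * y i)"

definition rotate_pair :: "'i set \<Rightarrow> real \<Rightarrow> ('i \<Rightarrow> real) \<times> ('i \<Rightarrow> real) \<Rightarrow> ('i \<Rightarrow> real) \<times> ('i \<Rightarrow> real)" where
  "rotate_pair I t = (\<lambda>(x, y). (lin_comb I (cos t) (sin t) x y, lin_comb I (- sin t) (cos t) x y))"

lemma measurable_lin_comb [measurable]:
  "(\<lambda>z. lin_comb I c s (fst z) (snd z)) \<in> measurable (gauss I \<Otimes>\<^sub>M gauss I) (gauss I)"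
  unfolding lin_comb_def gauss_def by measurable

lemma measurable_rotate_pair [measurable]:
  "rotate_pair I t \<in> measurable (gauss I \<Otimes>\<^sub>M gauss I) (gauss I \<Otimes>\<^sub>M gauss I)"
  unfolding rotate_pair_def split_beta by measurable

lemma rotate_pair_iterate:
  assumes "x \<in> space (gauss I)" "y \<in> space (gauss I)"
  shows "(rotate_pair I t ^^ k) (x, y) = rotate_pair I (real k * t) (x, y)"
proof (induction k)
  case 0
  with assms show ?case
    by (auto simp: rotate_pair_def lin_comb_def PiE_def extensional_restrict)
next
  case (Suc k)
  have e: "real (Suc k) * t = real k * t + t" by (simp add: algebra_simps)
  show ?case
    unfolding funpow.simps o_apply Suc.IH unfolding e
    by (auto simp: rotate_pair_def lin_comb_def sin_add cos_add algebra_simps)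
qed

text \<open>Turns a pair of independent vectors into one vector of independent pairs, so that a
  rotation acts coordinate by coordinate. Boxes are measured by slicing: each section at a fixed
  first vector is again a box.\<close>

lemma gauss_pair_zip:
  fixes I :: "'i set"
  assumes I: "finite I"
  shows "distr (gauss I \<Otimes>\<^sub>M gauss I) (\<Pi>\<^sub>M i\<in>I. std_gauss \<Otimes>\<^sub>M std_gauss) (\<lambda>(x, y). \<lambda>i\<in>I. (x i, y i))
    = (\<Pi>\<^sub>M i\<in>I. std_gauss \<Otimes>\<^sub>M std_gauss)"
proof -
  let ?P = "std_gauss \<Otimes>\<^sub>M std_gauss" and ?Z = "\<lambda>(x, y). \<lambda>i\<in>I. (x i, y i)"
  interpret P: pair_prob_space std_gauss std_gauss ..
  interpret PP: product_prob_space "\<lambda>_. ?P" I by unfold_locales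
  interpret G: prob_space "gauss I" by (rule prob_space_gauss)
  have m: "?Z \<in> measurable (gauss I \<Otimes>\<^sub>M gauss I) (PiM I (\<lambda>_. ?P))"
    unfolding gauss_def by measurable
  show ?thesis
  proof (rule PP.PiM_eqI[OF I])
    fix A :: "'i \<Rightarrow> (real \<times> real) set" assume A[measurable]: "\<And>i. i \<in> I \<Longrightarrow> A i \<in> sets ?P"
    let ?C = "{z \<in> space (gauss I \<Otimes>\<^sub>M gauss I). \<forall>i\<in>I. (fst z i, snd z i) \<in> A i}"
    have [measurable]: "(\<lambda>z. (fst z i, snd z i)) \<in> measurable (gauss I \<Otimes>\<^sub>M gauss I) ?P" if "i \<in> I" for i
      using that unfolding gauss_def by measurable
    have C: "?C \<in> sets (gauss I \<Otimes>\<^sub>M gauss I)"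
      using I by measurable
    have "emeasure (distr (gauss I \<Otimes>\<^sub>M gauss I) (PiM I (\<lambda>_. ?P)) ?Z) (Pi\<^sub>E I A)
        = emeasure (gauss I \<Otimes>\<^sub>M gauss I) (?Z -` Pi\<^sub>E I A \<inter> space (gauss I \<Otimes>\<^sub>M gauss I))"
      using A I by (intro emeasure_distr m sets_PiM_I_finite) auto
    also have "?Z -` Pi\<^sub>E I A \<inter> space (gauss I \<Otimes>\<^sub>M gauss I) = ?C"
      by (auto simp: PiE_iff)
    also have "emeasure (gauss I \<Otimes>\<^sub>M gauss I) ?C = (\<integral>\<^sup>+x. emeasure (gauss I) (Pair x -` ?C) \<partial>gauss I)"
      by (rule G.emeasure_pair_measure_alt[OF C])
    also have "\<dots> = (\<integral>\<^sup>+x. (\<Prod>i\<in>I. emeasure std_gauss (Pair (x i) -` A i)) \<partial>gauss I)"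
    proof (rule nn_integral_cong)
      fix x assume x: "x \<in> space (gauss I)"
      have "Pair x -` ?C = (\<Pi>\<^sub>E i\<in>I. Pair (x i) -` A i)"
        using x by (auto simp: space_pair_measure PiE_iff extensional_def)
      then show "emeasure (gauss I) (Pair x -` ?C) = (\<Prod>i\<in>I. emeasure std_gauss (Pair (x i) -` A i))"
        unfolding gauss_def using I A by (simp add: std_gauss_prod.emeasure_PiM sets_Pair1)
    qed
    also have "\<dots> = (\<Prod>i\<in>I. \<integral>\<^sup>+t. emeasure std_gauss (Pair t -` A i) \<partial>std_gauss)"
      unfolding gauss_def
      by (rule std_gauss_prod.product_nn_integral_prod[OF I])
         (rule std_gauss.measurable_emeasure_Pair[OF A])
    also have "\<dots> = (\<Prod>i\<in>I. emeasure ?P (A i))"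
      using A by (intro prod.cong refl std_gauss.emeasure_pair_measure_alt[symmetric])
    finally show "emeasure (distr (gauss I \<Otimes>\<^sub>M gauss I) (PiM I (\<lambda>_. ?P)) ?Z) (Pi\<^sub>E I A)
        = (\<Prod>i\<in>I. emeasure ?P (A i))" .
  qed simp
qed

text \<open>Zip with \<open>?Z\<close>, rotate every coordinate pair by \<open>?T\<close>, unzip
  with \<open>?U\<close>; each of the three maps carries one measure to the next.\<close>

lemma gauss_pair_rotate:
  fixes I :: "'i set"
  assumes I: "finite I" and t: "cos t \<noteq> 0"
  shows "distr (gauss I \<Otimes>\<^sub>M gauss I) (gauss I \<Otimes>\<^sub>M gauss I) (rotate_pair I t) = gauss I \<Otimes>\<^sub>M gauss I"
proof -
  let ?P = "std_gauss \<Otimes>\<^sub>M std_gauss" and ?Z = "\<lambda>(x, y). \<lambda>i\<in>I. (x i, y i)"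
  let ?Q = "\<Pi>\<^sub>M i\<in>I. ?P" and ?GG = "gauss I \<Otimes>\<^sub>M gauss I"
  let ?U = "\<lambda>w. (\<lambda>i\<in>I. fst (w i), \<lambda>i\<in>I. snd (w i))"
  let ?T = "\<lambda>(x, y). (cos t * x + sin t * y, cos t * y - sin t * x)"
  interpret P: pair_prob_space std_gauss std_gauss ..
  interpret PP: product_prob_space "\<lambda>_. ?P" I by unfold_locales
  have mZ: "?Z \<in> measurable ?GG ?Q" and mU: "?U \<in> measurable ?Q ?GG"
    unfolding gauss_def by measurable
  have mT: "?T \<in> measurable ?P ?P" by measurable
  have mC: "compose I ?T \<in> measurable ?Q ?Q"
    unfolding compose_def by measurable
  have UZ: "distr ?Q ?GG ?U = ?GG"
  proof -
    have "distr ?Q ?GG ?U = distr ?GG ?GG (?U \<circ> ?Z)"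
      by (subst gauss_pair_zip[OF I, symmetric], subst distr_distr[OF mU mZ]) rule
    also have "\<dots> = distr ?GG ?GG (\<lambda>z. z)"
      by (rule distr_cong)
         (auto simp: space_pair_measure PiE_def extensional_def fun_eq_iff restrict_def)
    finally show ?thesis by (simp add: distr_id2)
  qed
  have T: "distr ?P ?P ?T = ?P"
  proof -
    have "distr ?P ?P ?T = distr ?P (borel \<Otimes>\<^sub>M borel) ?T"
      by (rule distr_cong) (auto cong: sets_pair_measure_cong)
    then show ?thesis using std_gauss_pair_rotation[of "cos t" "sin t"] t by simp
  qed
  have "distr ?GG ?GG (rotate_pair I t) = distr ?GG ?GG (?U \<circ> (compose I ?T \<circ> ?Z))"
    by (rule distr_cong)
       (auto simp: rotate_pair_def lin_comb_def compose_def fun_eq_iff restrict_def)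
  also have "\<dots> = distr (distr (distr ?GG ?Q ?Z) ?Q (compose I ?T)) ?GG ?U"
    using mZ mC mU by (simp add: distr_distr o_assoc)
  also have "distr (distr ?GG ?Q ?Z) ?Q (compose I ?T) = ?Q"
    unfolding gauss_pair_zip[OF I]
    by (subst distr_PiM_finite_prob_space'[OF I])
       (auto intro: P.prob_space_axioms mT simp: T)
  finally show ?thesis unfolding UZ .
qed

lemma nn_integral_gauss_pair_rotate:
  assumes I: "finite I" and t: "cos t \<noteq> 0" and f[measurable]: "f \<in> borel_measurable (gauss I \<Otimes>\<^sub>M gauss I)"
  shows "(\<integral>\<^sup>+z. f ((rotate_pair I t ^^ k) z) \<partial>(gauss I \<Otimes>\<^sub>M gauss I)) = (\<integral>\<^sup>+z. f z \<partial>(gauss I \<Otimes>\<^sub>M gauss I))"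
proof (induction k)
  case (Suc k)
  let ?GG = "gauss I \<Otimes>\<^sub>M gauss I"
  have [measurable]: "(rotate_pair I t ^^ k) \<in> measurable ?GG ?GG"
    by (induction k) (auto intro: measurable_comp)
  have "(\<integral>\<^sup>+z. f ((rotate_pair I t ^^ Suc k) z) \<partial>?GG) = (\<integral>\<^sup>+z. f ((rotate_pair I t ^^ k) (rotate_pair I t z)) \<partial>?GG)"
    by (simp add: funpow_swap1)
  also have "\<dots> = (\<integral>\<^sup>+z. f ((rotate_pair I t ^^ k) z) \<partial>distr ?GG ?GG (rotate_pair I t))"
    by (subst nn_integral_distr) auto
  also have "\<dots> = (\<integral>\<^sup>+z. f z \<partial>?GG)"
    unfolding gauss_pair_rotate[OF I t] by (rule Suc.IH)
  finally show ?case .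
qed simp

section \<open>Concentration for minima of linear forms\<close>

text \<open>Lets the number of rotation steps tend to infinity; \<open>K / real n\<close> collects
  the second-order errors of all steps.\<close>

lemma ennreal_le_of_le_add_inverse:
  fixes A :: ennreal
  assumes "\<And>n. n \<ge> n0 \<Longrightarrow> A \<le> ennreal (B + K / real n)"
  shows "A \<le> ennreal B"
proof -
  have "(\<lambda>n. B + K / real n) \<longlonglongrightarrow> B + 0"
    by (intro tendsto_intros real_tendsto_divide_at_top filterlim_real_sequentially)
  then have "(\<lambda>n. ennreal (B + K / real n)) \<longlonglongrightarrow> ennreal B"
    by (intro tendsto_ennrealI) simp
  then show ?thesis
    by (rule LIMSEQ_le_const) (use assms in blast)
qed

text \<open>Bounding pi by 4 gives \<open>t \<le> 2 / real n\<close>; the factor 2 in the later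
  estimates of one step comes from here. The drift \<open>1 - cos t\<close> equals twice the square
  of \<open>sin (t / 2)\<close> and is therefore of second order.\<close>

lemma quarter_turn_step:
  fixes n :: nat
  assumes n: "n \<ge> 2"
  defines "t \<equiv> pi / (2 * real n)"
  shows "cos t > 0" "0 \<le> sin t" "sin t \<le> 2 / real n" "1 - cos t \<le> 2 / (real n)\<^sup>2" "real n * t = pi / 2"
proof -
  have t0: "0 < t" using n by (simp add: t_def)
  have "pi * 2 \<le> pi * real n" using n by (intro mult_left_mono) auto
  then have t1: "t \<le> pi / 4" using n by (simp add: t_def field_simps)
  have t2: "t \<le> 2 / real n"
    using n pi_less_4 by (simp add: t_def field_simps)
  show "cos t > 0" using t0 t1 by (intro cos_gt_zero_pi) auto
  show "0 \<le> sin t" using t0 t1 by (intro sin_ge_zero) auto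
  show "sin t \<le> 2 / real n" using sin_x_le_x[of t] t0 t2 by simp
  have "(sin (t / 2))\<^sup>2 \<le> (t / 2)\<^sup>2"
    using t0 t1 sin_x_le_x[of "t / 2"] by (intro power_mono sin_ge_zero) auto
  then have "1 - t\<^sup>2 / 2 \<le> cos t"
    using cos_double_sin[of "t / 2"] by (simp add: power_divide)
  moreover have "t\<^sup>2 \<le> (2 / real n)\<^sup>2" using t0 t2 by (intro power_mono) auto
  ultimately show "1 - cos t \<le> 2 / (real n)\<^sup>2" by (simp add: power_divide)
  show "real n * t = pi / 2" using n by (simp add: t_def)
qed

lemma abs_le_exp_sum: "\<bar>x::real\<bar> \<le> exp x + exp (- x)"
  using exp_ge_add_one_self[of x] exp_ge_add_one_self[of "- x"] exp_gt_zero[of x] exp_gt_zero[of "- x"]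
  by linarith

lemma square_le_exp_sum: "(x::real)\<^sup>2 \<le> exp x + exp (- x)"
proof -
  have *: "u\<^sup>2 \<le> exp u + exp (- u)" if "0 \<le> u" for u :: real
  proof -
    \<comment> \<open>The quadratic Taylor bound is taken at \<open>u / 2\<close> and squared,
      because \<open>1 + u + u\<^sup>2 / 2\<close> itself falls below \<open>u\<^sup>2\<close> for
      large \<open>u\<close>.\<close>
    have "(1 + u / 2 + (u / 2)\<^sup>2 / 2)\<^sup>2 \<le> (exp (u / 2))\<^sup>2"
      using that by (intro power_mono exp_lower_Taylor_quadratic) auto
    also have "\<dots> = exp u" by (simp add: exp_double[symmetric])
    finally have "u\<^sup>2 + 1 + u * ((1 - u / 4)\<^sup>2 + (u / 4)\<^sup>2) \<le> exp u"
      using zero_le_power2[of "u\<^sup>2"] by (simp add: power2_eq_square algebra_simps)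
    moreover have "0 \<le> u * ((1 - u / 4)\<^sup>2 + (u / 4)\<^sup>2)" using that by simp
    ultimately show ?thesis using exp_gt_zero[of "- u"] by linarith
  qed
  show ?thesis
    using *[of x] *[of "- x"] by (cases "0 \<le> x") auto
qed

text \<open>Jensen for the average of the numbers \<open>real n * u k\<close>: the tangent of exp at
  their mean lies below exp, and its linear terms cancel in the sum.\<close>

lemma exp_mean_le:
  fixes u :: "nat \<Rightarrow> real"
  assumes n: "n > 0"
  shows "exp (\<Sum>k<n. u k) \<le> (\<Sum>k<n. exp (real n * u k) / real n)"
proof -
  let ?m = "\<Sum>k<n. u k"
  have "exp ?m = (\<Sum>k<n. exp ?m * (1 + (real n * u k - ?m)) / real n)"
    using n by (simp add: sum_divide_distrib[symmetric] sum_distrib_left[symmetric] sum.distrib sum_subtractf)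
  also have "\<dots> \<le> (\<Sum>k<n. exp (real n * u k) / real n)"
  proof (intro sum_mono divide_right_mono)
    fix k
    have "exp ?m * (1 + (real n * u k - ?m)) \<le> exp ?m * exp (real n * u k - ?m)"
      by (intro mult_left_mono exp_ge_add_one_self) simp
    then show "exp ?m * (1 + (real n * u k - ?m)) \<le> exp (real n * u k)"
      by (simp add: exp_add[symmetric])
  qed simp
  finally show ?thesis .
qed

text \<open>Convexity between 0 and \<open>u\<close>. With \<open>c\<close> of order
  \<open>1 / n\<close> it turns the exponential of a drift into 1 plus an error of order
  \<open>1 / n\<close> with an integrable factor.\<close>

lemma exp_interpolate:
  fixes u :: real
  assumes "0 \<le> c" "c \<le> 1"
  shows "exp (c * u) \<le> 1 + c * exp u"
proof -
  have "exp ((1 - c) *\<^sub>R 0 + c *\<^sub>R u) \<le> (1 - c) * exp 0 + c * exp u"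
    using exp_convex assms by (intro convex_onD[of UNIV exp]) auto
  then show ?thesis using assms by simp
qed

text \<open>The setting for concentration: finitely many linear forms of variance at most 1. Every
  constant derived from it is independent of \<open>I\<close> and of the number of forms, which
  makes the later bounds uniform in \<open>N\<close>.\<close>

locale gauss_min =
  fixes I :: "'i set" and S :: "('i \<Rightarrow> real) set"
  assumes fin_I: "finite I" and fin_S: "finite S" and S_ne: "S \<noteq> {}"
    and norm_le_1: "a \<in> S \<Longrightarrow> (\<Sum>i\<in>I. (a i)\<^sup>2) \<le> 1"
begin

definition lin :: "('i \<Rightarrow> real) \<Rightarrow> ('i \<Rightarrow> real) \<Rightarrow> real" where
  "lin a x = (\<Sum>i\<in>I. a i * x i)"

definition lo :: "('i \<Rightarrow> real) \<Rightarrow> real" where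
  "lo x = Min ((\<lambda>a. lin a x) ` S)"

sublocale G: prob_space "gauss I"
  by (rule prob_space_gauss)

sublocale P: pair_prob_space "gauss I" "gauss I" ..

lemma prob_PiE_UNIV [simp]: "G.prob (\<Pi>\<^sub>E i\<in>I. UNIV) = 1"
  using G.prob_space by simp

lemma measurable_lin [measurable]: "lin a \<in> borel_measurable (gauss I)"
  unfolding lin_def gauss_def by measurable

lemma measurable_lo [measurable]: "lo \<in> borel_measurable (gauss I)"
  unfolding lo_def by (rule borel_measurable_Min[OF fin_S]) simp

lemma lo_le: "a \<in> S \<Longrightarrow> lo x \<le> lin a x"
  unfolding lo_def using fin_S by simp

lemma lo_attained: "\<exists>a\<in>S. lo x = lin a x"
proof -
  have "lo x \<in> (\<lambda>a. lin a x) ` S"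
    unfolding lo_def using fin_S S_ne by (intro Min_in) auto
  then show ?thesis by auto
qed

lemma lin_lin_comb: "lin a (lin_comb I c s x y) = c * lin a x + s * lin a y"
  unfolding lin_def lin_comb_def by (simp add: sum_distrib_left sum.distrib algebra_simps)

lemma nn_exp_lin: "a \<in> S \<Longrightarrow> (\<integral>\<^sup>+x. ennreal (exp (l * lin a x)) \<partial>gauss I) \<le> ennreal (exp (l\<^sup>2 / 2))"
  unfolding lin_def gauss_mgf[OF fin_I]
  using norm_le_1[of a] by (intro ennreal_leI) (simp add: mult_left_le)

lemma integrable_exp_lin: "a \<in> S \<Longrightarrow> integrable (gauss I) (\<lambda>x. exp (l * lin a x))"
  using nn_exp_lin[of a l] by (intro integrableI_bounded) (auto intro: order.strict_trans1)

lemma integral_exp_lin: "a \<in> S \<Longrightarrow> (\<integral>x. exp (l * lin a x) \<partial>gauss I) \<le> exp (l\<^sup>2 / 2)"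
  using nn_exp_lin[of a l] nn_integral_eq_integral[OF integrable_exp_lin[of a l]] by simp

text \<open>Serves the first absolute and the second moment of a form at once, with the crude
  constant \<open>2 * exp (1 / 2) \<le> 4\<close>.\<close>

lemma lin_bound:
  assumes a: "a \<in> S" and [measurable]: "g \<in> borel_measurable (gauss I)"
    and g: "\<And>x. 0 \<le> g x" "\<And>x. g x \<le> exp (lin a x) + exp (- lin a x)"
  shows "integrable (gauss I) g" "(\<integral>x. g x \<partial>gauss I) \<le> 4"
proof -
  have i: "integrable (gauss I) (\<lambda>x. exp (lin a x) + exp (- lin a x))"
    using integrable_exp_lin[OF a, of 1] integrable_exp_lin[OF a, of "-1"] by simp
  show "integrable (gauss I) g"
    by (rule Bochner_Integration.integrable_bound[OF i]) (use g in auto)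
  then have "(\<integral>x. g x \<partial>gauss I) \<le> (\<integral>x. exp (lin a x) + exp (- lin a x) \<partial>gauss I)"
    using i g by (intro integral_mono) auto
  also have "\<dots> \<le> exp (1 / 2) + exp (1 / 2)"
    using integral_exp_lin[OF a, of 1] integral_exp_lin[OF a, of "-1"]
      integrable_exp_lin[OF a, of 1] integrable_exp_lin[OF a, of "-1"] by simp
  also have "\<dots> \<le> 4" using exp_half_le2 by simp
  finally show "(\<integral>x. g x \<partial>gauss I) \<le> 4" .
qed

lemma integrable_exp_abs_lo: "integrable (gauss I) (\<lambda>x. exp (l * \<bar>lo x\<bar>))"
proof -
  have i: "integrable (gauss I) (\<lambda>x. \<Sum>a\<in>S. exp (\<bar>l\<bar> * lin a x) + exp (- \<bar>l\<bar> * lin a x))"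
    by (intro Bochner_Integration.integrable_sum Bochner_Integration.integrable_add integrable_exp_lin)
  show ?thesis
  proof (rule Bochner_Integration.integrable_bound[OF i])
    show "AE x in gauss I. norm (exp (l * \<bar>lo x\<bar>)) \<le> norm (\<Sum>a\<in>S. exp (\<bar>l\<bar> * lin a x) + exp (- \<bar>l\<bar> * lin a x))"
    proof (rule AE_I2)
      fix x
      obtain a where a: "a \<in> S" "lo x = lin a x" using lo_attained by blast
      have "exp (l * \<bar>lo x\<bar>) \<le> exp (\<bar>l\<bar> * \<bar>lin a x\<bar>)"
        using a by (simp add: mult_right_mono)
      also have "\<dots> \<le> exp (\<bar>l\<bar> * lin a x) + exp (- \<bar>l\<bar> * lin a x)"
        by (cases "0 \<le> lin a x") auto
      also have "\<dots> \<le> (\<Sum>a\<in>S. exp (\<bar>l\<bar> * lin a x) + exp (- \<bar>l\<bar> * lin a x))"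
        using a fin_S by (intro member_le_sum[of a S "\<lambda>a. exp (\<bar>l\<bar> * lin a x) + exp (- \<bar>l\<bar> * lin a x)"]) auto
      finally show "norm (exp (l * \<bar>lo x\<bar>)) \<le> norm (\<Sum>a\<in>S. exp (\<bar>l\<bar> * lin a x) + exp (- \<bar>l\<bar> * lin a x))"
        by (simp add: abs_of_nonneg)
    qed
  qed measurable
qed

lemma integrable_exp_lo: "integrable (gauss I) (\<lambda>x. exp (l * lo x))"
  by (rule Bochner_Integration.integrable_bound[OF integrable_exp_abs_lo[of "\<bar>l\<bar>"]])
     (auto simp: abs_mult[symmetric])

lemma integrable_lo: "integrable (gauss I) lo"
  by (rule Bochner_Integration.integrable_bound[OF Bochner_Integration.integrable_add[OF integrable_exp_lo[of 1] integrable_exp_lo[of "-1"]]])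
     (auto simp: abs_of_nonneg abs_le_exp_sum)

lemma integrable_lo_square: "integrable (gauss I) (\<lambda>x. (lo x)\<^sup>2)"
  by (rule Bochner_Integration.integrable_bound[OF Bochner_Integration.integrable_add[OF integrable_exp_lo[of 1] integrable_exp_lo[of "-1"]]])
     (auto simp: abs_of_nonneg square_le_exp_sum)

text \<open>
  \<open>q\<close> telescopes along the path of \<open>n\<close> rotations by \<open>pi / (2 * n)\<close> from \<open>x\<close> to \<open>y\<close>; rotation invariance
  makes all \<open>n\<close> increments equal in law to the first one.
\<close>

lemma quarter_turn_bound:
  fixes q r :: "real \<Rightarrow> real \<Rightarrow> real"
  assumes n: "n \<ge> 2"
    and tele: "\<And>w :: nat \<Rightarrow> real. q (w 0) (w n) \<le> (\<Sum>k<n. r (w k) (w (Suc k)))"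
    and r0: "\<And>u v. 0 \<le> r u v"
    and [measurable]: "case_prod r \<in> borel_measurable (borel \<Otimes>\<^sub>M borel)"
    and a: "\<And>x. x \<in> space (gauss I) \<Longrightarrow>
       (\<integral>\<^sup>+y. ennreal (r (lo x) (lo (lin_comb I (cos (pi / (2 * real n))) (sin (pi / (2 * real n))) x y))) \<partial>gauss I) \<le> ennreal (b x)"
    and b: "integrable (gauss I) b" "\<And>x. 0 \<le> b x"
  shows "(\<integral>\<^sup>+x. \<integral>\<^sup>+y. ennreal (q (lo x) (lo y)) \<partial>gauss I \<partial>gauss I) \<le> ennreal (real n * (\<integral>x. b x \<partial>gauss I))"
proof -
  let ?GG = "gauss I \<Otimes>\<^sub>M gauss I"
  define t where "t = pi / (2 * real n)"
  note t = quarter_turn_step[OF n, folded t_def]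
  let ?R = "rotate_pair I t"
  define \<Phi> where "\<Phi> z = ennreal (r (lo (fst z)) (lo (lin_comb I (cos t) (sin t) (fst z) (snd z))))" for z
  have [measurable]: "\<Phi> \<in> borel_measurable ?GG"
  proof -
    have [measurable]: "(\<lambda>z. lo (lin_comb I (cos t) (sin t) (fst z) (snd z))) \<in> borel_measurable ?GG"
      using measurable_compose[OF measurable_lin_comb measurable_lo] .
    have "(\<lambda>z. case_prod r (lo (fst z), lo (lin_comb I (cos t) (sin t) (fst z) (snd z)))) \<in> borel_measurable ?GG"
      by measurable
    then show ?thesis unfolding \<Phi>_def by simp
  qed
  have [measurable]: "(?R ^^ k) \<in> measurable ?GG ?GG" for k
    by (induction k) (auto intro: measurable_comp)
  have pt: "ennreal (q (lo x) (lo y)) \<le> (\<Sum>k<n. \<Phi> ((?R ^^ k) (x, y)))"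
    if x: "x \<in> space (gauss I)" and y: "y \<in> space (gauss I)" for x y
  proof -
    let ?w = "\<lambda>k. lo (fst ((?R ^^ k) (x, y)))"
    have "fst ((?R ^^ n) (x, y)) = y"
      unfolding rotate_pair_iterate[OF x y] t(5) using y
      by (auto simp: rotate_pair_def lin_comb_def PiE_def extensional_restrict)
    then have "q (lo x) (lo y) = q (?w 0) (?w n)" by simp
    also have "\<dots> \<le> (\<Sum>k<n. r (?w k) (?w (Suc k)))" by (rule tele)
    finally have "ennreal (q (lo x) (lo y)) \<le> (\<Sum>k<n. ennreal (r (?w k) (?w (Suc k))))"
      using r0 by (simp add: sum_ennreal ennreal_leI)
    also have "\<dots> = (\<Sum>k<n. \<Phi> ((?R ^^ k) (x, y)))"
      by (intro sum.cong refl) (simp add: \<Phi>_def rotate_pair_def split_beta)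
    finally show ?thesis .
  qed
  have "(\<integral>\<^sup>+x. \<integral>\<^sup>+y. ennreal (q (lo x) (lo y)) \<partial>gauss I \<partial>gauss I)
      \<le> (\<integral>\<^sup>+x. \<integral>\<^sup>+y. (\<Sum>k<n. \<Phi> ((?R ^^ k) (x, y))) \<partial>gauss I \<partial>gauss I)"
    using pt by (intro nn_integral_mono)
  also have "\<dots> = (\<integral>\<^sup>+z. (\<Sum>k<n. \<Phi> ((?R ^^ k) z)) \<partial>?GG)"
    by (rule G.nn_integral_fst) measurable
  also have "\<dots> = (\<Sum>k<n. \<integral>\<^sup>+z. \<Phi> ((?R ^^ k) z) \<partial>?GG)"
    by (rule nn_integral_sum) measurable
  also have "\<dots> = of_nat n * (\<integral>\<^sup>+z. \<Phi> z \<partial>?GG)"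
    using t(1) by (subst nn_integral_gauss_pair_rotate[OF fin_I]) auto
  also have "(\<integral>\<^sup>+z. \<Phi> z \<partial>?GG) = (\<integral>\<^sup>+x. \<integral>\<^sup>+y. \<Phi> (x, y) \<partial>gauss I \<partial>gauss I)"
    by (rule G.nn_integral_fst[symmetric]) measurable
  also have "\<dots> \<le> (\<integral>\<^sup>+x. ennreal (b x) \<partial>gauss I)"
    using a by (intro nn_integral_mono) (simp add: \<Phi>_def t_def)
  also have "\<dots> = ennreal (\<integral>x. b x \<partial>gauss I)"
    using b by (intro nn_integral_eq_integral) auto
  finally show ?thesis
    using b by (simp add: ennreal_of_nat_eq_real_of_nat ennreal_mult' mult_left_mono)
qed

text \<open>The substitute for a derivative: the minimizer at \<open>x\<close> is tested at the
  rotated point. With \<open>c = cos t\<close> the drift term is of second order in the angle, and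
  \<open>a\<close> is fixed before \<open>y\<close> is drawn.\<close>

lemma lo_step:
  assumes "a \<in> S" "lo x = lin a x"
  shows "lo (lin_comb I c s x y) - lo x \<le> (1 - c) * - lo x + s * lin a y"
  using lo_le[OF assms(1), of "lin_comb I c s x y"] assms(2) by (simp add: lin_lin_comb algebra_simps)

text \<open>Jensen over the steps costs a factor \<open>n\<close> in the exponent, which the step
  size compensates: the Gaussian exponent is \<open>(n * l * sin t)\<^sup>2 / 2\<close>, at most
  \<open>(2 * l)\<^sup>2 / 2\<close>. For nonnegative \<open>l\<close> the one-sided estimate
  \<open>lo_step\<close> is enough.\<close>

lemma exp_difference:
  assumes l: "0 \<le> l"
  shows "(\<integral>\<^sup>+x. \<integral>\<^sup>+y. ennreal (exp (l * (lo y - lo x))) \<partial>gauss I \<partial>gauss I) \<le> ennreal (exp (2 * l\<^sup>2))"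
proof -
  define K where "K = exp (2 * l\<^sup>2) * (2 * l) * (\<integral>x. exp \<bar>lo x\<bar> \<partial>gauss I)"
  have "(\<integral>\<^sup>+x. \<integral>\<^sup>+y. ennreal (exp (l * (lo y - lo x))) \<partial>gauss I \<partial>gauss I) \<le> ennreal (exp (2 * l\<^sup>2) + K / real n)"
    if n: "n \<ge> max 2 (nat \<lceil>2 * l\<rceil>)" for n
  proof -
    from n have n2: "n \<ge> 2" and nl: "2 * l \<le> real n" by linarith+
    define t where "t = pi / (2 * real n)"
    note t = quarter_turn_step[OF n2, folded t_def]
    let ?c = "cos t" and ?s = "sin t"
    let ?b = "\<lambda>x. exp (2 * l\<^sup>2) * (1 + 2 * l / real n * exp \<bar>lo x\<bar>) / real n"
    have i: "integrable (gauss I) (\<lambda>x. exp \<bar>lo x\<bar>)"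
      using integrable_exp_abs_lo[of 1] by simp
    have "(\<integral>\<^sup>+x. \<integral>\<^sup>+y. ennreal (exp (l * (lo y - lo x))) \<partial>gauss I \<partial>gauss I) \<le> ennreal (real n * (\<integral>x. ?b x \<partial>gauss I))"
    proof (rule quarter_turn_bound[where q = "\<lambda>u v. exp (l * (v - u))"
            and r = "\<lambda>u v. exp (real n * (l * (v - u))) / real n", OF n2])
      fix w :: "nat \<Rightarrow> real"
      have "l * (w n - w 0) = (\<Sum>k<n. l * (w (Suc k) - w k))"
        unfolding sum_distrib_left[symmetric] sum_lessThan_telescope ..
      then show "exp (l * (w n - w 0)) \<le> (\<Sum>k<n. exp (real n * (l * (w (Suc k) - w k))) / real n)"
        using exp_mean_le[of n "\<lambda>k. l * (w (Suc k) - w k)"] n2 by simp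
    next
      fix x assume "x \<in> space (gauss I)"
      obtain a where a: "a \<in> S" "lo x = lin a x" using lo_attained by blast
      \<comment> \<open>The drift factor does not involve \<open>y\<close>, so only the Gaussian
        factor is integrated over \<open>y\<close>.\<close>
      let ?e = "exp (real n * l * (1 - ?c) * \<bar>lo x\<bar>) / real n"
      have "(\<integral>\<^sup>+y. ennreal (exp (real n * (l * (lo (lin_comb I ?c ?s x y) - lo x))) / real n) \<partial>gauss I)
          \<le> (\<integral>\<^sup>+y. ennreal ?e * ennreal (exp ((real n * l * ?s) * lin a y)) \<partial>gauss I)"
      proof (rule nn_integral_mono)
        fix y
        have "lo (lin_comb I ?c ?s x y) - lo x \<le> (1 - ?c) * - lo x + ?s * lin a y"
          by (rule lo_step[OF a])
        also have "\<dots> \<le> (1 - ?c) * \<bar>lo x\<bar> + ?s * lin a y"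
          by (intro add_right_mono mult_left_mono) auto
        finally have "real n * l * (lo (lin_comb I ?c ?s x y) - lo x)
            \<le> real n * l * ((1 - ?c) * \<bar>lo x\<bar> + ?s * lin a y)"
          using l by (intro mult_left_mono) auto
        then have "exp (real n * (l * (lo (lin_comb I ?c ?s x y) - lo x))) / real n
            \<le> ?e * exp ((real n * l * ?s) * lin a y)"
          by (simp add: exp_add[symmetric] divide_right_mono algebra_simps)
        then show "ennreal (exp (real n * (l * (lo (lin_comb I ?c ?s x y) - lo x))) / real n)
            \<le> ennreal ?e * ennreal (exp ((real n * l * ?s) * lin a y))"
          by (simp add: ennreal_mult'[symmetric] ennreal_leI)
      qed
      also have "\<dots> = ennreal ?e * (\<integral>\<^sup>+y. ennreal (exp ((real n * l * ?s) * lin a y)) \<partial>gauss I)"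
        by (rule nn_integral_cmult) measurable
      also have "\<dots> \<le> ennreal ?e * ennreal (exp ((real n * l * ?s)\<^sup>2 / 2))"
        by (intro mult_left_mono nn_exp_lin a) simp
      also have "\<dots> = ennreal (?e * exp ((real n * l * ?s)\<^sup>2 / 2))"
        by (rule ennreal_mult'[symmetric]) simp
      also have "\<dots> \<le> ennreal (?b x)"
      proof (rule ennreal_leI)
        have "real n * l * ?s \<le> real n * l * (2 / real n)"
          using l t by (intro mult_left_mono) auto
        then have "real n * l * ?s \<le> 2 * l" using n2 by simp
        then have "(real n * l * ?s)\<^sup>2 \<le> (2 * l)\<^sup>2"
          using l t by (intro power_mono) auto
        then have 1: "exp ((real n * l * ?s)\<^sup>2 / 2) \<le> exp (2 * l\<^sup>2)"
          by (simp add: power_mult_distrib)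
        have "real n * l * (1 - ?c) \<le> real n * l * (2 / (real n)\<^sup>2)"
          using l t by (intro mult_left_mono) auto
        also have "\<dots> = 2 * l / real n" using n2 by (simp add: power2_eq_square)
        finally have "exp (real n * l * (1 - ?c) * \<bar>lo x\<bar>) \<le> exp (2 * l / real n * \<bar>lo x\<bar>)"
          unfolding exp_le_cancel_iff by (rule mult_right_mono) simp
        \<comment> \<open>Here \<open>2 * l \<le> real n\<close> is used. The error has an
          integrable factor, and after summation over the \<open>n\<close> steps it contributes
          \<open>K / real n\<close>.\<close>
        also have "\<dots> \<le> 1 + 2 * l / real n * exp \<bar>lo x\<bar>"
          using l nl n2 by (intro exp_interpolate) (auto simp: field_simps)
        finally have 2: "?e \<le> (1 + 2 * l / real n * exp \<bar>lo x\<bar>) / real n"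
          by (intro divide_right_mono) auto
        have "?e * exp ((real n * l * ?s)\<^sup>2 / 2) \<le> (1 + 2 * l / real n * exp \<bar>lo x\<bar>) / real n * exp (2 * l\<^sup>2)"
          using 1 2 l by (intro mult_mono) auto
        then show "?e * exp ((real n * l * ?s)\<^sup>2 / 2) \<le> ?b x" by (simp add: mult.commute)
      qed
      finally show "(\<integral>\<^sup>+y. ennreal (exp (real n * (l * (lo (lin_comb I (cos (pi / (2 * real n))) (sin (pi / (2 * real n))) x y) - lo x))) / real n) \<partial>gauss I)
          \<le> ennreal (?b x)" unfolding t_def .
    qed (use i l in auto)
    also have "real n * (\<integral>x. ?b x \<partial>gauss I) = exp (2 * l\<^sup>2) + K / real n"
      using i n2 by (simp add: K_def algebra_simps add_divide_distrib)
    finally show ?thesis .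
  qed
  then show ?thesis by (rule ennreal_le_of_le_add_inverse)
qed

text \<open>Upward steps of the clipped path that start outside the window have length at least
  \<open>\<tau>\<close>; they are charged quadratically, which vanishes as \<open>n\<close> grows. A
  step from inside the window costs on average at most \<open>(2 / n) * 4\<close>, with 4 from
  \<open>lin_bound\<close>; over \<open>n\<close> steps this is the factor 8.\<close>

lemma clip_difference:
  fixes \<tau> m :: real
  assumes \<tau>: "0 < \<tau>"
  defines "\<psi> \<equiv> \<lambda>v. max (- \<tau>) (min \<tau> (v - m))"
  shows "(\<integral>\<^sup>+x. \<integral>\<^sup>+y. ennreal (max 0 (\<psi> (lo y) - \<psi> (lo x))) \<partial>gauss I \<partial>gauss I)
    \<le> ennreal (8 * measure (gauss I) {x \<in> space (gauss I). \<bar>lo x - m\<bar> \<le> 2 * \<tau>})"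
proof -
  let ?M = "{x \<in> space (gauss I). \<bar>lo x - m\<bar> \<le> 2 * \<tau>}"
  define K where "K = 2 * (\<integral>x. \<bar>lo x\<bar> \<partial>gauss I) + 2 / \<tau> * (4 * (\<integral>x. (lo x)\<^sup>2 \<partial>gauss I) + 16)"
  have M [measurable]: "?M \<in> sets (gauss I)" by measurable
  have Mi: "?M \<inter> space (gauss I) = ?M" by auto
  have iM: "integrable (gauss I) (\<lambda>x. indicator ?M x :: real)"
    using M by (simp add: G.emeasure_eq_measure)
  \<comment> \<open>A rise of less than \<open>\<tau>\<close> from below the window ends below
    \<open>m - \<tau>\<close>, where \<open>\<psi>\<close> is still constant; above the window
    \<open>\<psi>\<close> is already maximal. Otherwise \<open>\<tau> \<le> d\<close>, hence
    \<open>d \<le> d\<^sup>2 / \<tau>\<close>.\<close>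
  have clip: "max 0 (\<psi> v - \<psi> u) \<le> (if \<bar>u - m\<bar> \<le> 2 * \<tau> then d else 0) + d\<^sup>2 / \<tau>"
    if d: "v - u \<le> d" "0 \<le> d" for u v d
  proof (cases "\<bar>u - m\<bar> \<le> 2 * \<tau> \<or> d < \<tau>")
    case True
    then show ?thesis using d \<tau> unfolding \<psi>_def
      by (auto simp: max_def min_def intro: add_increasing2)
  next
    case False
    then have "\<tau> \<le> d" by simp
    then have "d * \<tau> \<le> d * d" using d by (intro mult_left_mono) auto
    then have "d \<le> d\<^sup>2 / \<tau>" using \<tau> by (simp add: field_simps power2_eq_square)
    moreover have "max 0 (\<psi> v - \<psi> u) \<le> d"
      using d \<tau> unfolding \<psi>_def by (auto simp: max_def min_def)
    ultimately show ?thesis using False by simp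
  qed
  have "(\<integral>\<^sup>+x. \<integral>\<^sup>+y. ennreal (max 0 (\<psi> (lo y) - \<psi> (lo x))) \<partial>gauss I \<partial>gauss I)
      \<le> ennreal (8 * measure (gauss I) ?M + K / real n)"
    if n: "n \<ge> 2" for n
  proof -
    define t where "t = pi / (2 * real n)"
    note t = quarter_turn_step[OF n, folded t_def]
    let ?c = "cos t" and ?s = "sin t"
    let ?b = "\<lambda>x. 8 / real n * indicator ?M x + 2 / (real n)\<^sup>2 * \<bar>lo x\<bar> + 2 / \<tau> * (4 / (real n)^4 * (lo x)\<^sup>2 + 16 / (real n)\<^sup>2)"
    have "(\<integral>\<^sup>+x. \<integral>\<^sup>+y. ennreal (max 0 (\<psi> (lo y) - \<psi> (lo x))) \<partial>gauss I \<partial>gauss I)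
        \<le> ennreal (real n * (\<integral>x. ?b x \<partial>gauss I))"
    proof (rule quarter_turn_bound[where q = "\<lambda>u v. max 0 (\<psi> v - \<psi> u)"
            and r = "\<lambda>u v. max 0 (\<psi> v - \<psi> u)", OF n])
      fix w :: "nat \<Rightarrow> real"
      have "\<psi> (w n) - \<psi> (w 0) = (\<Sum>k<n. \<psi> (w (Suc k)) - \<psi> (w k))"
        by (rule sum_lessThan_telescope[symmetric])
      also have "\<dots> \<le> (\<Sum>k<n. max 0 (\<psi> (w (Suc k)) - \<psi> (w k)))"
        by (intro sum_mono) auto
      finally show "max 0 (\<psi> (w n) - \<psi> (w 0)) \<le> (\<Sum>k<n. max 0 (\<psi> (w (Suc k)) - \<psi> (w k)))"
        by (simp add: sum_nonneg)
    next
      show "(\<lambda>(u, v). max 0 (\<psi> v - \<psi> u)) \<in> borel_measurable (borel \<Otimes>\<^sub>M borel)"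
        unfolding \<psi>_def by measurable
    next
      fix x assume x: "x \<in> space (gauss I)"
      obtain a where a: "a \<in> S" "lo x = lin a x" using lo_attained by blast
      let ?i = "indicator ?M x :: real"
      let ?g = "\<lambda>y. ?i * (2 / (real n)\<^sup>2 * \<bar>lo x\<bar> + 2 / real n * \<bar>lin a y\<bar>)
          + 2 / \<tau> * (4 / (real n)^4 * (lo x)\<^sup>2 + 4 / (real n)\<^sup>2 * (lin a y)\<^sup>2)"
      have b1: "integrable (gauss I) (\<lambda>y. \<bar>lin a y\<bar>)" "(\<integral>y. \<bar>lin a y\<bar> \<partial>gauss I) \<le> 4"
        by (rule lin_bound[OF a(1)]; simp add: abs_le_exp_sum)+
      have b2: "integrable (gauss I) (\<lambda>y. (lin a y)\<^sup>2)" "(\<integral>y. (lin a y)\<^sup>2 \<partial>gauss I) \<le> 4"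
        by (rule lin_bound[OF a(1)]; simp add: square_le_exp_sum)+
      have "(\<integral>\<^sup>+y. ennreal (max 0 (\<psi> (lo (lin_comb I ?c ?s x y)) - \<psi> (lo x))) \<partial>gauss I)
          \<le> (\<integral>\<^sup>+y. ennreal (?g y) \<partial>gauss I)"
      proof (intro nn_integral_mono ennreal_leI)
        fix y
        \<comment> \<open>\<open>d1\<close> bounds the drift and \<open>d2\<close> the Gaussian part
          of one step.\<close>
        define d1 where "d1 = 2 / (real n)\<^sup>2 * \<bar>lo x\<bar>"
        define d2 where "d2 = 2 / real n * \<bar>lin a y\<bar>"
        have d0: "0 \<le> d1" "0 \<le> d2" by (auto simp: d1_def d2_def)
        have "(1 - ?c) * - lo x \<le> (1 - ?c) * \<bar>lo x\<bar>" by (intro mult_left_mono) auto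
        also have "\<dots> \<le> d1" unfolding d1_def using t by (intro mult_right_mono) auto
        finally have 1: "(1 - ?c) * - lo x \<le> d1" .
        have "?s * lin a y \<le> ?s * \<bar>lin a y\<bar>" using t by (intro mult_left_mono) auto
        also have "\<dots> \<le> d2" unfolding d2_def using t by (intro mult_right_mono) auto
        finally have "lo (lin_comb I ?c ?s x y) - lo x \<le> d1 + d2"
          using 1 lo_step[OF a, of ?c ?s y] by linarith
        from clip[OF this] have "max 0 (\<psi> (lo (lin_comb I ?c ?s x y)) - \<psi> (lo x)) \<le> ?i * (d1 + d2) + (d1 + d2)\<^sup>2 / \<tau>"
          using d0 x by (simp add: indicator_def split: if_splits)
        moreover have "(d1 + d2)\<^sup>2 \<le> 2 * (d1\<^sup>2 + d2\<^sup>2)"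
          using zero_le_power2[of "d1 - d2"] by (simp add: power2_eq_square algebra_simps)
        then have "(d1 + d2)\<^sup>2 / \<tau> \<le> 2 * (d1\<^sup>2 + d2\<^sup>2) / \<tau>"
          using \<tau> by (intro divide_right_mono) auto
        moreover have "2 * (d1\<^sup>2 + d2\<^sup>2) / \<tau> = 2 / \<tau> * (4 / (real n)^4 * (lo x)\<^sup>2 + 4 / (real n)\<^sup>2 * (lin a y)\<^sup>2)"
          by (simp add: d1_def d2_def power_mult_distrib power_divide)
        ultimately show "max 0 (\<psi> (lo (lin_comb I ?c ?s x y)) - \<psi> (lo x)) \<le> ?g y"
          unfolding d1_def[symmetric] d2_def[symmetric] by linarith
      qed
      also have "\<dots> = ennreal (\<integral>y. ?g y \<partial>gauss I)"
        using b1 b2 \<tau> by (intro nn_integral_eq_integral) auto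
      also have "\<dots> \<le> ennreal (?b x)"
      proof (rule ennreal_leI)
        have "(\<integral>y. ?g y \<partial>gauss I) = ?i * (2 / (real n)\<^sup>2 * \<bar>lo x\<bar> + 2 / real n * (\<integral>y. \<bar>lin a y\<bar> \<partial>gauss I))
          + 2 / \<tau> * (4 / (real n)^4 * (lo x)\<^sup>2 + 4 / (real n)\<^sup>2 * (\<integral>y. (lin a y)\<^sup>2 \<partial>gauss I))"
          using b1 b2 by simp
        also have "\<dots> \<le> ?i * (2 / (real n)\<^sup>2 * \<bar>lo x\<bar> + 2 / real n * 4)
          + 2 / \<tau> * (4 / (real n)^4 * (lo x)\<^sup>2 + 4 / (real n)\<^sup>2 * 4)"
          using b1 b2 \<tau> by (intro add_mono mult_left_mono) auto
        also have "\<dots> \<le> ?b x"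
          by (simp add: indicator_def)
        finally show "(\<integral>y. ?g y \<partial>gauss I) \<le> ?b x" .
      qed
      finally show "(\<integral>\<^sup>+y. ennreal (max 0 (\<psi> (lo (lin_comb I (cos (pi / (2 * real n))) (sin (pi / (2 * real n))) x y)) - \<psi> (lo x))) \<partial>gauss I)
          \<le> ennreal (?b x)" unfolding t_def .
    qed (use iM integrable_lo integrable_lo_square \<tau> in auto)
    also have "real n * (\<integral>x. ?b x \<partial>gauss I) \<le> 8 * measure (gauss I) ?M + K / real n"
    proof -
      have "(\<integral>x. ?b x \<partial>gauss I) = 8 / real n * measure (gauss I) ?M + 2 / (real n)\<^sup>2 * (\<integral>x. \<bar>lo x\<bar> \<partial>gauss I)
          + 2 / \<tau> * (4 / (real n)^4 * (\<integral>x. (lo x)\<^sup>2 \<partial>gauss I) + 16 / (real n)\<^sup>2)"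
        using iM Mi integrable_lo integrable_lo_square by simp
      also have "4 / (real n)^4 * (\<integral>x. (lo x)\<^sup>2 \<partial>gauss I) \<le> 4 / (real n)\<^sup>2 * (\<integral>x. (lo x)\<^sup>2 \<partial>gauss I)"
        using n by (intro mult_right_mono divide_left_mono power_increasing) auto
      finally have "(\<integral>x. ?b x \<partial>gauss I) \<le> 8 / real n * measure (gauss I) ?M + 2 / (real n)\<^sup>2 * (\<integral>x. \<bar>lo x\<bar> \<partial>gauss I)
          + 2 / \<tau> * (4 / (real n)\<^sup>2 * (\<integral>x. (lo x)\<^sup>2 \<partial>gauss I) + 16 / (real n)\<^sup>2)"
        using \<tau> by (simp add: divide_right_mono)
      then have "real n * (\<integral>x. ?b x \<partial>gauss I) \<le> real n * (8 / real n * measure (gauss I) ?M + 2 / (real n)\<^sup>2 * (\<integral>x. \<bar>lo x\<bar> \<partial>gauss I)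
          + 2 / \<tau> * (4 / (real n)\<^sup>2 * (\<integral>x. (lo x)\<^sup>2 \<partial>gauss I) + 16 / (real n)\<^sup>2))"
        by (intro mult_left_mono) auto
      also have "\<dots> = 8 * measure (gauss I) ?M + K / real n"
        using n \<tau> by (simp add: K_def power2_eq_square field_simps)
      finally show ?thesis .
    qed
    finally show ?thesis by (simp add: ennreal_leI)
  qed
  then show ?thesis by (rule ennreal_le_of_le_add_inverse)
qed

end

text \<open>A Paley-Zygmund argument. Mean zero makes the positive part of \<open>h\<close> carry
  half of the absolute mean, at least \<open>m\<close>. Values below \<open>m / 2\<close> contribute
  at most \<open>m / 2\<close>; the rest lives on \<open>?A\<close>, where \<open>h\<close> is
  bounded by \<open>\<rho> * h\<^sup>2 + 1 / (4 * \<rho>)\<close>, in place of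
  Cauchy-Schwarz.\<close>

lemma (in prob_space) mean_zero_anti_concentration:
  fixes h :: "'a \<Rightarrow> real"
  assumes i: "integrable M h" "integrable M (\<lambda>x. (h x)\<^sup>2)"
    and mean: "expectation h = 0" and K: "expectation (\<lambda>x. (h x)\<^sup>2) \<le> K"
    and m: "0 < m" "2 * m \<le> expectation (\<lambda>x. \<bar>h x\<bar>)"
  shows "m\<^sup>2 / (4 * K) \<le> prob {x \<in> space M. m / 2 \<le> h x}"
proof -
  let ?A = "{x \<in> space M. m / 2 \<le> h x}"
  have [measurable]: "h \<in> borel_measurable M" using i by auto
  have A [measurable]: "?A \<in> sets M" by measurable
  have iA: "integrable M (\<lambda>x. indicator ?A x :: real)"
    by (simp add: emeasure_eq_measure)
  have K0: "0 < K"
  proof (rule ccontr)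
    assume "\<not> 0 < K"
    moreover have "0 \<le> expectation (\<lambda>x. (h x)\<^sup>2)"
      by (rule Bochner_Integration.integral_nonneg) simp
    ultimately have "expectation (\<lambda>x. (h x)\<^sup>2) = 0"
      using K by linarith
    then have "AE x in M. (h x)\<^sup>2 = 0"
      using i by (subst (asm) integral_nonneg_eq_0_iff_AE) auto
    then have "AE x in M. \<bar>h x\<bar> = 0" by simp
    then have "expectation (\<lambda>x. \<bar>h x\<bar>) = expectation (\<lambda>x. 0)"
      by (intro integral_cong_AE) auto
    then show False using m by simp
  qed
  \<comment> \<open>Chosen so that the second-moment term \<open>2 * \<rho> * K\<close> equals
    \<open>m / 2\<close>, leaving the other \<open>m / 2\<close> for the probability of
    \<open>?A\<close>.\<close>
  define \<rho> where "\<rho> = m / (4 * K)"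
  have \<rho>: "0 < \<rho>" using m K0 by (simp add: \<rho>_def)
  have "\<bar>h x\<bar> + h x \<le> m + 2 * (\<rho> * (h x)\<^sup>2 + 1 / (4 * \<rho>) * indicator ?A x)" if "x \<in> space M" for x
  proof (cases "x \<in> ?A")
    case True
    have "0 \<le> (2 * \<rho> * h x - 1)\<^sup>2" by simp
    then have "h x \<le> \<rho> * (h x)\<^sup>2 + 1 / (4 * \<rho>)"
      using \<rho> by (simp add: power2_eq_square field_simps)
    then show ?thesis using True m by simp
  next
    case False
    then have "\<bar>h x\<bar> + h x \<le> m" using that m by auto
    then show ?thesis using \<rho> by (intro add_increasing2) auto
  qed
  then have "expectation (\<lambda>x. \<bar>h x\<bar> + h x) \<le> expectation (\<lambda>x. m + 2 * (\<rho> * (h x)\<^sup>2 + 1 / (4 * \<rho>) * indicator ?A x))"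
    using i iA by (intro integral_mono) auto
  then have "expectation (\<lambda>x. \<bar>h x\<bar>) \<le> m + 2 * (\<rho> * expectation (\<lambda>x. (h x)\<^sup>2) + 1 / (4 * \<rho>) * prob ?A)"
    using i iA mean by (simp add: prob_space)
  also have "\<dots> \<le> m + 2 * (\<rho> * K + 1 / (4 * \<rho>) * prob ?A)"
    using K \<rho> by simp
  finally have "m \<le> 2 * \<rho> * K + 1 / (2 * \<rho>) * prob ?A" using m by simp
  moreover have "2 * \<rho> * K = m / 2" using K0 by (simp add: \<rho>_def)
  moreover have "1 / (2 * \<rho>) = 2 * K / m" by (simp add: \<rho>_def)
  ultimately have "m / 2 \<le> 2 * K / m * prob ?A" by simp
  then show ?thesis using m K0 by (simp add: field_simps power2_eq_square)
qed

section \<open>Tails, small values and shifts of the deviation from the mean\<close>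

context gauss_min
begin

definition dev :: "('i \<Rightarrow> real) \<Rightarrow> real" where
  "dev x = lo x - (\<integral>x. lo x \<partial>gauss I)"

lemma measurable_dev [measurable]: "dev \<in> borel_measurable (gauss I)"
  unfolding dev_def by measurable

lemma integrable_dev: "integrable (gauss I) dev"
  unfolding dev_def using integrable_lo by (simp add: G.emeasure_eq_measure)

lemma integral_dev: "(\<integral>x. dev x \<partial>gauss I) = 0"
  unfolding dev_def using integrable_lo by simp

lemma integrable_exp_dev: "integrable (gauss I) (\<lambda>x. exp (l * dev x))"
proof -
  have "integrable (gauss I) (\<lambda>x. exp (l * lo x) * exp (- l * (\<integral>x. lo x \<partial>gauss I)))"
    by (intro integrable_mult_left integrable_exp_lo)
  then show ?thesis unfolding dev_def by (simp add: exp_add[symmetric] algebra_simps)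
qed

lemma exp_dev_ge_1: "1 \<le> (\<integral>x. exp (l * dev x) \<partial>gauss I)"
proof -
  have "(\<integral>x. 1 + l * dev x \<partial>gauss I) \<le> (\<integral>x. exp (l * dev x) \<partial>gauss I)"
    using integrable_dev integrable_exp_dev
    by (intro integral_mono) (auto simp: G.emeasure_eq_measure)
  then show ?thesis using integrable_dev integral_dev by simp
qed

text \<open>
  The bound on the symmetrized exponential moment is a product of two factors that are both
  at least 1 by Jensen's inequality.
\<close>

lemma exp_dev_le: "(\<integral>x. exp (l * dev x) \<partial>gauss I) \<le> exp (2 * l\<^sup>2)"
proof -
  let ?A = "\<lambda>l. \<integral>x. exp (l * dev x) \<partial>gauss I"
  have *: "?A k * ?A (- k) \<le> exp (2 * k\<^sup>2)" if "0 \<le> k" for k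
  proof -
    have nn: "(\<integral>\<^sup>+x. ennreal (exp (l * dev x)) \<partial>gauss I) = ennreal (?A l)" for l
      using integrable_exp_dev by (intro nn_integral_eq_integral) auto
    have "ennreal (?A k * ?A (- k)) = (\<integral>\<^sup>+x. ennreal (exp (k * dev x)) \<partial>gauss I) * (\<integral>\<^sup>+x. ennreal (exp (- k * dev x)) \<partial>gauss I)"
      unfolding nn by (simp add: ennreal_mult')
    also have "\<dots> = (\<integral>\<^sup>+x. \<integral>\<^sup>+y. ennreal (exp (k * dev y)) * ennreal (exp (- k * dev x)) \<partial>gauss I \<partial>gauss I)"
      by (simp add: nn_integral_multc nn_integral_cmult)
    also have "\<dots> = (\<integral>\<^sup>+x. \<integral>\<^sup>+y. ennreal (exp (k * (lo y - lo x))) \<partial>gauss I \<partial>gauss I)"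
      by (intro nn_integral_cong) (simp add: ennreal_mult'[symmetric] exp_add[symmetric] dev_def algebra_simps)
    also have "\<dots> \<le> ennreal (exp (2 * k\<^sup>2))"
      by (rule exp_difference[OF that])
    finally show ?thesis by simp
  qed
  have **: "?A k \<le> exp (2 * k\<^sup>2) \<and> ?A (- k) \<le> exp (2 * k\<^sup>2)" if "0 \<le> k" for k
  proof -
    have "?A k * 1 \<le> ?A k * ?A (- k)" "1 * ?A (- k) \<le> ?A k * ?A (- k)"
      using exp_dev_ge_1[of k] exp_dev_ge_1[of "- k"]
      by (intro mult_left_mono mult_right_mono; simp)+
    then show ?thesis using *[OF that] by linarith
  qed
  show ?thesis
    using **[of l] **[of "- l"] by (cases "0 \<le> l") auto
qed

text \<open>Chernoff with the parameter \<open>t / 4\<close>, which minimizes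
  \<open>2 * l\<^sup>2 - l * t\<close>; the factor 2 counts the two signs.\<close>

lemma dev_tail:
  assumes t: "0 < t"
  shows "measure (gauss I) {x \<in> space (gauss I). t < \<bar>dev x\<bar>} \<le> 2 * exp (- t\<^sup>2 / 8)"
proof -
  have one: "measure (gauss I) {x \<in> space (gauss I). t \<le> \<sigma> * dev x} \<le> exp (- t\<^sup>2 / 8)"
    if \<sigma>: "\<sigma> = 1 \<or> \<sigma> = -1" for \<sigma> :: real
  proof -
    have "{x \<in> space (gauss I). t \<le> \<sigma> * dev x} = {x \<in> space (gauss I). exp (t\<^sup>2 / 4) \<le> exp ((t * \<sigma> / 4) * dev x)}"
      using t by (auto simp: power2_eq_square mult.assoc)
    also have "measure (gauss I) \<dots> \<le> (\<integral>x. exp ((t * \<sigma> / 4) * dev x) \<partial>gauss I) / exp (t\<^sup>2 / 4)"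
      by (intro integral_Markov_inequality_measure[where A = "{}"] integrable_exp_dev) auto
    also have "\<dots> \<le> exp (2 * (t * \<sigma> / 4)\<^sup>2) / exp (t\<^sup>2 / 4)"
      by (intro divide_right_mono exp_dev_le) simp
    also have "\<dots> = exp (- t\<^sup>2 / 8)"
      using \<sigma> by (auto simp: exp_diff[symmetric] power_mult_distrib power_divide)
    finally show ?thesis .
  qed
  have "measure (gauss I) {x \<in> space (gauss I). t < \<bar>dev x\<bar>}
      \<le> measure (gauss I) ({x \<in> space (gauss I). t \<le> 1 * dev x} \<union> {x \<in> space (gauss I). t \<le> -1 * dev x})"
    by (rule G.finite_measure_mono, force, measurable)
  also have "\<dots> \<le> measure (gauss I) {x \<in> space (gauss I). t \<le> 1 * dev x} + measure (gauss I) {x \<in> space (gauss I). t \<le> -1 * dev x}"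
    by (rule measure_Un_le) measurable
  also have "\<dots> \<le> 2 * exp (- t\<^sup>2 / 8)"
    using one[of 1] one[of "-1"] by simp
  finally show ?thesis .
qed

text \<open>The value 18 is \<open>2 * exp 2\<close> with \<open>exp 1 \<le> 3\<close>; it matters
  only that it does not depend on \<open>I\<close> and \<open>S\<close>.\<close>

lemma integrable_dev_square: "integrable (gauss I) (\<lambda>x. (dev x)\<^sup>2)"
  and dev_second_moment: "(\<integral>x. (dev x)\<^sup>2 \<partial>gauss I) \<le> 18"
proof -
  have i: "integrable (gauss I) (\<lambda>x. exp (dev x) + exp (- dev x))"
    using integrable_exp_dev[of 1] integrable_exp_dev[of "-1"] by simp
  show i2: "integrable (gauss I) (\<lambda>x. (dev x)\<^sup>2)"
    by (rule Bochner_Integration.integrable_bound[OF i]) (auto simp: abs_of_nonneg square_le_exp_sum)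
  have "(\<integral>x. (dev x)\<^sup>2 \<partial>gauss I) \<le> (\<integral>x. exp (dev x) + exp (- dev x) \<partial>gauss I)"
    using i i2 by (intro integral_mono square_le_exp_sum)
  also have "\<dots> \<le> exp 2 + exp 2"
    using exp_dev_le[of 1] exp_dev_le[of "-1"] integrable_exp_dev[of 1] integrable_exp_dev[of "-1"] by simp
  also have "exp (2::real) = exp 1 * exp 1" by (simp add: exp_add[symmetric])
  also have "exp (1::real) * exp 1 \<le> 3 * 3" using exp_le by (intro mult_mono) auto
  finally show "(\<integral>x. (dev x)\<^sup>2 \<partial>gauss I) \<le> 18" by simp
qed

text \<open>For \<open>y\<close> in \<open>U\<close> and an independent \<open>x\<close> in
  \<open>L\<close> the clipped values are \<open>\<tau>\<close> and \<open>- \<tau>\<close>. A path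
  between them has to cross the window around the mean, which \<open>clip_difference\<close>
  quantifies.\<close>

lemma dev_gap:
  assumes \<tau>: "0 < \<tau>"
  shows "2 * \<tau> * measure (gauss I) {x \<in> space (gauss I). \<tau> \<le> dev x}
      * measure (gauss I) {x \<in> space (gauss I). \<tau> \<le> - dev x}
    \<le> 8 * measure (gauss I) {x \<in> space (gauss I). \<bar>dev x\<bar> \<le> 2 * \<tau>}"
proof -
  define U L where "U = {x \<in> space (gauss I). \<tau> \<le> dev x}" and "L = {x \<in> space (gauss I). \<tau> \<le> - dev x}"
  let ?m = "\<integral>x. lo x \<partial>gauss I"
  define \<psi> where "\<psi> v = max (- \<tau>) (min \<tau> (v - ?m))" for v
  have UL [measurable]: "U \<in> sets (gauss I)" "L \<in> sets (gauss I)"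
    unfolding U_def L_def by measurable
  have "ennreal (2 * \<tau> * G.prob U * G.prob L) = (\<integral>\<^sup>+x. \<integral>\<^sup>+y. ennreal (2 * \<tau>) * indicator U y * indicator L x \<partial>gauss I \<partial>gauss I)"
  proof -
    have "(\<integral>\<^sup>+x. \<integral>\<^sup>+y. ennreal (2 * \<tau>) * indicator U y * indicator L x \<partial>gauss I \<partial>gauss I)
        = (\<integral>\<^sup>+x. ennreal (2 * \<tau>) * emeasure (gauss I) U * indicator L x \<partial>gauss I)"
      by (intro nn_integral_cong, subst nn_integral_multc, measurable) (simp only: nn_integral_cmult_indicator[OF UL(1)])
    also have "\<dots> = ennreal (2 * \<tau>) * emeasure (gauss I) U * emeasure (gauss I) L"
      by (rule nn_integral_cmult_indicator) measurable
    finally show ?thesis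
      using \<tau> by (simp add: G.emeasure_eq_measure ennreal_mult)
  qed
  also have "\<dots> \<le> (\<integral>\<^sup>+x. \<integral>\<^sup>+y. ennreal (max 0 (\<psi> (lo y) - \<psi> (lo x))) \<partial>gauss I \<partial>gauss I)"
  proof (intro nn_integral_mono)
    fix x y
    show "ennreal (2 * \<tau>) * indicator U y * indicator L x \<le> ennreal (max 0 (\<psi> (lo y) - \<psi> (lo x)))"
      using \<tau> unfolding indicator_def \<psi>_def U_def L_def dev_def by (auto intro!: ennreal_leI)
  qed
  also have "\<dots> \<le> ennreal (8 * G.prob {x \<in> space (gauss I). \<bar>lo x - ?m\<bar> \<le> 2 * \<tau>})"
    unfolding \<psi>_def by (rule clip_difference[OF \<tau>])
  finally show ?thesis unfolding U_def L_def dev_def by (simp add: ennreal_le_iff)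
qed

text \<open>The density \<open>w\<close> of the shifted law has second moment \<open>exp\<close> of
  the squared norm of \<open>v\<close>, at most 3. The inequality
  \<open>w \<le> R + w\<^sup>2 / R\<close> separates its bounded part from its large values.\<close>

lemma gauss_shift_prob:
  assumes v: "(\<Sum>i\<in>I. (v i)\<^sup>2) \<le> 1" and A [measurable]: "A \<in> sets (gauss I)" and R: "0 < R"
  shows "measure (gauss I) {x \<in> space (gauss I). (\<lambda>i\<in>I. x i + v i) \<in> A} \<le> R * measure (gauss I) A + 3 / R"
proof -
  let ?w = "\<lambda>x. \<Prod>i\<in>I. exp (v i * x i - (v i)\<^sup>2 / 2)"
  have [measurable]: "(\<lambda>x. \<lambda>i\<in>I. x i + v i) \<in> measurable (gauss I) (gauss I)"
    unfolding gauss_def by measurable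
  have w: "?w x = exp (lin v x - (\<Sum>i\<in>I. (v i)\<^sup>2) / 2)" for x
    using fin_I by (simp add: exp_sum[symmetric] sum_subtractf lin_def sum_divide_distrib)
  have "(\<integral>\<^sup>+x. ennreal ((?w x)\<^sup>2) \<partial>gauss I) = (\<integral>\<^sup>+x. ennreal (exp (- (\<Sum>i\<in>I. (v i)\<^sup>2))) * ennreal (exp (2 * lin v x)) \<partial>gauss I)"
    unfolding w by (intro nn_integral_cong) (simp add: exp_double[symmetric] ennreal_mult'[symmetric] exp_add[symmetric])
  also have "\<dots> = ennreal (exp (- (\<Sum>i\<in>I. (v i)\<^sup>2))) * ennreal (exp (2\<^sup>2 * (\<Sum>i\<in>I. (v i)\<^sup>2) / 2))"
    unfolding lin_def gauss_mgf[OF fin_I, symmetric] by (rule nn_integral_cmult) (auto simp: gauss_def)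
  also have "\<dots> = ennreal (exp (\<Sum>i\<in>I. (v i)\<^sup>2))"
    by (simp add: ennreal_mult'[symmetric] exp_add[symmetric])
  also have "\<dots> \<le> ennreal 3"
  proof (rule ennreal_leI)
    have "exp (\<Sum>i\<in>I. (v i)\<^sup>2) \<le> exp 1" using v by simp
    then show "exp (\<Sum>i\<in>I. (v i)\<^sup>2) \<le> 3" using exp_le by linarith
  qed
  finally have w2: "(\<integral>\<^sup>+x. ennreal ((?w x)\<^sup>2) \<partial>gauss I) \<le> ennreal 3" .
  have wm [measurable]: "?w \<in> borel_measurable (gauss I)" unfolding w by measurable
  have "emeasure (gauss I) {x \<in> space (gauss I). (\<lambda>i\<in>I. x i + v i) \<in> A}
      = (\<integral>\<^sup>+x. indicator A (\<lambda>i\<in>I. x i + v i) \<partial>gauss I)"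
    by (subst nn_integral_indicator[symmetric], measurable, intro nn_integral_cong)
       (auto simp: indicator_def)
  also have "\<dots> = (\<integral>\<^sup>+x. ennreal (?w x) * indicator A x \<partial>gauss I)"
    using fin_I by (intro gauss_shift) auto
  also have "\<dots> \<le> (\<integral>\<^sup>+x. ennreal R * indicator A x + ennreal (1 / R) * ennreal ((?w x)\<^sup>2) \<partial>gauss I)"
  proof (rule nn_integral_mono)
    fix x
    have w0: "0 \<le> ?w x" by (simp add: prod_nonneg)
    have "?w x \<le> R + 1 / R * (?w x)\<^sup>2"
    proof (cases "?w x \<le> R")
      case True
      moreover have "0 \<le> 1 / R * (?w x)\<^sup>2" using R by simp
      ultimately show ?thesis by linarith
    next
      case False
      then have "R * ?w x \<le> ?w x * ?w x" using w0 by (intro mult_right_mono) auto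
      then have "?w x \<le> 1 / R * (?w x)\<^sup>2" using R by (simp add: field_simps power2_eq_square)
      then show ?thesis using R by linarith
    qed
    then have "ennreal (?w x) \<le> ennreal R + ennreal (1 / R) * ennreal ((?w x)\<^sup>2)"
      using R by (simp add: ennreal_mult'[symmetric] ennreal_plus[symmetric] ennreal_leI del: ennreal_plus)
    then show "ennreal (?w x) * indicator A x \<le> ennreal R * indicator A x + ennreal (1 / R) * ennreal ((?w x)\<^sup>2)"
      by (auto simp: indicator_def)
  qed
  also have "\<dots> = ennreal R * emeasure (gauss I) A + ennreal (1 / R) * (\<integral>\<^sup>+x. ennreal ((?w x)\<^sup>2) \<partial>gauss I)"
    using A by (subst nn_integral_add) (auto simp: nn_integral_cmult)
  also have "\<dots> \<le> ennreal R * emeasure (gauss I) A + ennreal (1 / R) * ennreal 3"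
    by (intro add_left_mono mult_left_mono w2) simp
  also have "ennreal (1 / R) * ennreal 3 = ennreal (3 / R)"
    using R by (subst ennreal_mult'[symmetric]) auto
  also have "ennreal R * emeasure (gauss I) A + ennreal (3 / R) = ennreal (R * measure (gauss I) A + 3 / R)"
    using R by (simp add: G.emeasure_eq_measure ennreal_mult'[symmetric] ennreal_plus[symmetric] del: ennreal_plus)
  finally have "ennreal (measure (gauss I) {x \<in> space (gauss I). (\<lambda>i\<in>I. x i + v i) \<in> A})
      \<le> ennreal (R * measure (gauss I) A + 3 / R)"
    by (simp only: G.emeasure_eq_measure)
  then show ?thesis
    by (subst (asm) ennreal_le_iff) (use R in auto)
qed

end

section \<open>Fluctuations bounded from below\<close>

context gauss_min
begin

text \<open>A drop by \<open>d\<close> is impossible if the deviation is below \<open>d / 3\<close>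
  in absolute value both before and after the shift. So one of the two is large, and
  \<open>gauss_shift_prob\<close> carries the second alternative back to the unshifted law.\<close>

lemma dev_spread:
  assumes v: "(\<Sum>i\<in>I. (v i)\<^sup>2) \<le> 1" and d: "0 < d" and p: "0 < p" "p \<le> 1"
    and drop: "p \<le> measure (gauss I) {x \<in> space (gauss I). lo (\<lambda>i\<in>I. x i + v i) \<le> lo x - d}"
  shows "p\<^sup>2 / 14 \<le> measure (gauss I) {x \<in> space (gauss I). d / 3 \<le> \<bar>dev x\<bar>}"
proof -
  define B where "B = {x \<in> space (gauss I). d / 3 \<le> \<bar>dev x\<bar>}"
  define B' where "B' = {x \<in> space (gauss I). (\<lambda>i\<in>I. x i + v i) \<in> B}"
  have B [measurable]: "B \<in> sets (gauss I)" unfolding B_def by measurable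
  have [measurable]: "(\<lambda>x. \<lambda>i\<in>I. x i + v i) \<in> measurable (gauss I) (gauss I)"
    unfolding gauss_def by measurable
  have B' [measurable]: "B' \<in> sets (gauss I)" unfolding B'_def by measurable
  have "{x \<in> space (gauss I). lo (\<lambda>i\<in>I. x i + v i) \<le> lo x - d} \<subseteq> B \<union> B'"
  proof
    fix x assume x: "x \<in> {x \<in> space (gauss I). lo (\<lambda>i\<in>I. x i + v i) \<le> lo x - d}"
    show "x \<in> B \<union> B'"
    proof (rule ccontr)
      assume "x \<notin> B \<union> B'"
      then have "\<bar>dev x\<bar> < d / 3" "\<bar>dev (\<lambda>i\<in>I. x i + v i)\<bar> < d / 3"
        using x unfolding B'_def B_def by auto
      moreover have "dev (\<lambda>i\<in>I. x i + v i) \<le> dev x - d"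
        using x by (simp add: dev_def)
      ultimately show False using d by linarith
    qed
  qed
  then have "p \<le> measure (gauss I) (B \<union> B')"
    using drop by (meson G.finite_measure_mono B B' sets.Un order_trans)
  also have "\<dots> \<le> measure (gauss I) B + measure (gauss I) B'"
    by (rule measure_Un_le) measurable
  \<comment> \<open>The choice \<open>R = 6 / p\<close> makes the error \<open>3 / R\<close> equal
    to \<open>p / 2\<close>, half of the available probability.\<close>
  also have "measure (gauss I) B' \<le> 6 / p * measure (gauss I) B + 3 / (6 / p)"
    unfolding B'_def using p by (intro gauss_shift_prob v B) auto
  finally have "p / 2 \<le> (1 + 6 / p) * measure (gauss I) B"
    by (simp add: distrib_right)
  then have "p * (p / 2) \<le> p * ((1 + 6 / p) * measure (gauss I) B)"
    using p by (intro mult_left_mono) auto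
  also have "\<dots> = (p + 6) * measure (gauss I) B"
    using p by (simp add: field_simps)
  also have "\<dots> \<le> 7 * measure (gauss I) B"
    using p by (intro mult_right_mono) auto
  finally show ?thesis unfolding B_def by (simp add: power2_eq_square)
qed

lemma dev_abs_mean:
  assumes "0 < d" "p \<le> measure (gauss I) {x \<in> space (gauss I). d \<le> \<bar>dev x\<bar>}"
  shows "d * p \<le> (\<integral>x. \<bar>dev x\<bar> \<partial>gauss I)"
proof -
  have "measure (gauss I) {x \<in> space (gauss I). d \<le> \<bar>dev x\<bar>} \<le> (\<integral>x. \<bar>dev x\<bar> \<partial>gauss I) / d"
    using assms integrable_dev by (intro integral_Markov_inequality_measure[where A = "{}"]) auto
  then have "p \<le> (\<integral>x. \<bar>dev x\<bar> \<partial>gauss I) / d" using assms by linarith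
  then show ?thesis using assms by (simp add: field_simps)
qed

text \<open>Since \<open>t / 2 \<le> m / 2\<close>, each one-sided tail at level
  \<open>t / 2\<close> has probability at least \<open>m\<^sup>2 / (4 * 18)\<close>, where 18 bounds
  the second moment. Then \<open>dev_gap\<close> with \<open>\<tau> = t / 2\<close> yields mass
  within distance \<open>t\<close> of the mean.\<close>

lemma dev_small_ball:
  assumes m: "0 < m" "2 * m \<le> (\<integral>x. \<bar>dev x\<bar> \<partial>gauss I)" and t: "0 < t" "t \<le> m"
  shows "measure (gauss I) {x \<in> space (gauss I). t < \<bar>dev x\<bar>} \<le> 1 - (m\<^sup>2 / 72)\<^sup>2 / 8 * t"
proof -
  let ?q = "m\<^sup>2 / 72"
  let ?U = "{x \<in> space (gauss I). t / 2 \<le> dev x}" and ?L = "{x \<in> space (gauss I). t / 2 \<le> - dev x}"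
  let ?M = "{x \<in> space (gauss I). \<bar>dev x\<bar> \<le> 2 * (t / 2)}"
  have "m\<^sup>2 / (4 * 18) \<le> G.prob {x \<in> space (gauss I). m / 2 \<le> dev x}"
    by (rule G.mean_zero_anti_concentration[OF integrable_dev integrable_dev_square integral_dev dev_second_moment m])
  also have "\<dots> \<le> G.prob ?U"
    using t by (intro G.finite_measure_mono, force, measurable)
  finally have U: "?q \<le> G.prob ?U" by simp
  have "m\<^sup>2 / (4 * 18) \<le> G.prob {x \<in> space (gauss I). m / 2 \<le> - dev x}"
    using integrable_dev integrable_dev_square integral_dev dev_second_moment m
    by (intro G.mean_zero_anti_concentration) auto
  also have "\<dots> \<le> G.prob ?L"
    using t by (intro G.finite_measure_mono, force, measurable)
  finally have L: "?q \<le> G.prob ?L" by simp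
  have "t * (?q * ?q) \<le> t * (G.prob ?U * G.prob ?L)"
    using U L t by (intro mult_left_mono mult_mono) auto
  also have "\<dots> \<le> 8 * G.prob ?M"
    using dev_gap[of "t / 2"] t by simp
  finally have "?q\<^sup>2 / 8 * t \<le> G.prob ?M" by (simp add: power2_eq_square mult.commute)
  also have "?M = space (gauss I) - {x \<in> space (gauss I). t < \<bar>dev x\<bar>}" by auto
  also have "G.prob \<dots> = 1 - G.prob {x \<in> space (gauss I). t < \<bar>dev x\<bar>}"
    by (rule G.prob_compl) measurable
  finally show ?thesis by simp
qed

end

text \<open>Each term of the minimum serves one range. Up to \<open>m\<close>,
  \<open>1 - \<kappa> * t \<le> exp (- \<kappa> * t)\<close> and
  \<open>C * t\<^sup>2 \<le> \<kappa> * t\<close>. Between \<open>m\<close> and 4, monotonicity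
  carries over the bound at \<open>m\<close>. From 4 on, half of the Gaussian exponent absorbs the
  2, as \<open>2 \<le> exp 1 \<le> exp (t\<^sup>2 / 16)\<close>.\<close>

lemma gaussian_tail_without_prefactor:
  fixes p :: "real \<Rightarrow> real"
  assumes m: "0 < m" and \<kappa>: "0 < \<kappa>"
    and mono: "\<And>s t. 0 < s \<Longrightarrow> s \<le> t \<Longrightarrow> p t \<le> p s"
    and large: "\<And>t. 0 < t \<Longrightarrow> p t \<le> 2 * exp (- t\<^sup>2 / 8)"
    and small: "\<And>t. 0 < t \<Longrightarrow> t \<le> m \<Longrightarrow> p t \<le> 1 - \<kappa> * t"
    and t: "0 < t"
  shows "p t \<le> exp (- min (1 / 16) (min (\<kappa> / m) (\<kappa> * m / 16)) * t\<^sup>2)"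
proof -
  define C where "C = min (1 / 16) (min (\<kappa> / m) (\<kappa> * m / 16))"
  have C: "0 \<le> C" "C \<le> 1 / 16" "C \<le> \<kappa> / m" "C \<le> \<kappa> * m / 16"
    unfolding C_def using m \<kappa> by (simp, linarith+)
  have lin: "p s \<le> exp (- \<kappa> * s)" if "0 < s" "s \<le> m" for s
    using small[OF that] exp_ge_add_one_self[of "- \<kappa> * s"] by simp
  consider "t \<le> m" | "m \<le> t" "t \<le> 4" | "4 \<le> t" by linarith
  then have "p t \<le> exp (- C * t\<^sup>2)"
  proof cases
    case 1
    have "C * t\<^sup>2 = (C * t) * t" by (simp add: power2_eq_square)
    also have "\<dots> \<le> (\<kappa> / m * m) * t"
      using C 1 t m \<kappa> by (intro mult_right_mono mult_mono) auto
    finally have "C * t\<^sup>2 \<le> \<kappa> * t" using m by simp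
    then have "exp (- \<kappa> * t) \<le> exp (- C * t\<^sup>2)" by simp
    then show ?thesis using lin[OF t 1] by linarith
  next
    case 2
    have "t\<^sup>2 \<le> 4\<^sup>2" using 2 t by (intro power_mono) auto
    then have "C * t\<^sup>2 \<le> (\<kappa> * m / 16) * 4\<^sup>2"
      using C \<kappa> m by (intro mult_mono) auto
    then have "exp (- \<kappa> * m) \<le> exp (- C * t\<^sup>2)" by simp
    then show ?thesis using lin[of m] mono[of m t] m 2 by linarith
  next
    case 3
    have sq: "4\<^sup>2 \<le> t\<^sup>2" using 3 by (intro power_mono) auto
    have "2 \<le> exp (1 :: real)" using exp_ge_add_one_self[of 1] by simp
    also have "\<dots> \<le> exp (t\<^sup>2 / 16)" using sq by simp
    finally have "2 * exp (- t\<^sup>2 / 8) \<le> exp (t\<^sup>2 / 16) * exp (- t\<^sup>2 / 8)"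
      by (intro mult_right_mono) auto
    also have "\<dots> = exp (- (1 / 16) * t\<^sup>2)" by (simp add: exp_add[symmetric])
    also have "\<dots> \<le> exp (- C * t\<^sup>2)"
      using mult_right_mono[OF C(2), of "t\<^sup>2"] by simp
    finally show ?thesis using large[OF t] by linarith
  qed
  then show ?thesis unfolding C_def .
qed

section \<open>Size of the minimizers\<close>

text \<open>This is \<open>sqrt N\<close> times the Hamiltonian of the configuration that occupies
  exactly \<open>T\<close>.\<close>

definition block_sum :: "(nat \<times> nat \<Rightarrow> real) \<Rightarrow> nat set \<Rightarrow> real" where
  "block_sum x T = (\<Sum>i\<in>T. \<Sum>j\<in>T. x (i, j))"

text \<open>The local field of a site \<open>i\<close> outside \<open>T\<close>: the cost of
  occupying \<open>i\<close> in addition to \<open>T\<close>.\<close>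

definition cross_sum :: "(nat \<times> nat \<Rightarrow> real) \<Rightarrow> nat set \<Rightarrow> nat \<Rightarrow> real" where
  "cross_sum x T i = x (i, i) + (\<Sum>j\<in>T. x (i, j) + x (j, i))"

lemma block_sum_insert:
  assumes "finite T" "i \<notin> T"
  shows "block_sum x (insert i T) = block_sum x T + cross_sum x T i"
  using assms by (simp add: block_sum_def cross_sum_def sum.distrib algebra_simps)

text \<open>
  A minimizer of maximal cardinality cannot be enlarged at zero cost, whence the strict inequality.
\<close>

lemma small_minimizer_cross_sums:
  assumes "\<And>T. T \<subseteq> {1..N} \<Longrightarrow> (\<And>T'. T' \<subseteq> {1..N} \<Longrightarrow> block_sum x T \<le> block_sum x T') \<Longrightarrow> 6 * card T < N"
  shows "\<exists>T\<subseteq>{1..N}. 6 * card T < N \<and> (\<forall>i\<in>{1..N} - T. 0 < cross_sum x T i)"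
proof -
  let ?min = "\<lambda>T. T \<subseteq> {1..N} \<and> (\<forall>T'. T' \<subseteq> {1..N} \<longrightarrow> block_sum x T \<le> block_sum x T')"
  have fin: "finite {T. ?min T}"
    by (rule finite_subset[of _ "Pow {1..N}"]) auto
  have "block_sum x ` Pow {1..N} \<noteq> {}" "finite (block_sum x ` Pow {1..N})" by auto
  then have "Min (block_sum x ` Pow {1..N}) \<in> block_sum x ` Pow {1..N}" by (rule Min_in[rotated])
  then obtain T0 where T0: "T0 \<subseteq> {1..N}" "block_sum x T0 = Min (block_sum x ` Pow {1..N})" by auto
  then have "?min T0" by simp
  then have "Max (card ` {T. ?min T}) \<in> card ` {T. ?min T}"
    using fin by (intro Max_in) auto
  then obtain T where T: "?min T" "card T = Max (card ` {T. ?min T})" by auto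
  then have max: "card T' \<le> card T" if "?min T'" for T'
    using that fin by (auto intro!: Max_ge)
  have "0 < cross_sum x T i" if i: "i \<in> {1..N} - T" for i
  proof (rule ccontr)
    assume n: "\<not> 0 < cross_sum x T i"
    have finT: "finite T" using T finite_subset by blast
    then have "block_sum x (insert i T) \<le> block_sum x T"
      using n i block_sum_insert[of T i x] by simp
    then have "?min (insert i T)" using T i by (auto intro: order_trans)
    then have "card (insert i T) \<le> card T" by (rule max)
    then show False using finT i by simp
  qed
  then show ?thesis using T assms[of T] by blast
qed

text \<open>The local fields of distinct sites outside \<open>T\<close> involve disjoint sets of
  couplings, so their signs can be reversed independently. Couplings inside \<open>T\<close>, or
  between distinct sites outside \<open>T\<close>, are left alone when \<open>U\<close> is disjoint
  from \<open>T\<close>.\<close>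

definition flip_sign :: "nat set \<Rightarrow> nat set \<Rightarrow> nat \<times> nat \<Rightarrow> real" where
  "flip_sign T U = (\<lambda>(i, j). if i \<in> U \<and> (j = i \<or> j \<in> T) \<or> j \<in> U \<and> i \<in> T then -1 else 1)"

lemma cross_sum_flip:
  assumes T: "T \<subseteq> {1..N}" and U: "U \<inter> T = {}" and i: "i \<in> {1..N}" "i \<notin> T"
  shows "cross_sum (\<lambda>p\<in>{1..N} \<times> {1..N}. flip_sign T U p * x p) T i = (if i \<in> U then -1 else 1) * cross_sum x T i"
proof -
  let ?s = "if i \<in> U then -1 else 1 :: real"
  have 1: "flip_sign T U (i, i) = ?s"
    using i by (auto simp: flip_sign_def)
  have 2: "flip_sign T U (i, j) = ?s" "flip_sign T U (j, i) = ?s" if "j \<in> T" for j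
    using U i that by (auto simp: flip_sign_def)
  have "cross_sum (\<lambda>p\<in>{1..N} \<times> {1..N}. flip_sign T U p * x p) T i
      = ?s * x (i, i) + (\<Sum>j\<in>T. ?s * x (i, j) + ?s * x (j, i))"
    unfolding cross_sum_def using T i 1 2 by (intro arg_cong2[where f = "(+)"] sum.cong) auto
  then show ?thesis
    by (simp add: cross_sum_def sum_distrib_left distrib_left)
qed

lemma measurable_cross_sum:
  assumes "T \<subseteq> {1..N}" "i \<in> {1..N}"
  shows "(\<lambda>x. cross_sum x T i) \<in> borel_measurable (gauss ({1..N} \<times> {1..N}))"
proof -
  have "(\<lambda>x. x p) \<in> borel_measurable (gauss ({1..N} \<times> {1..N}))" if "p \<in> {1..N} \<times> {1..N}" for p
    unfolding gauss_def using measurable_component_singleton[OF that, of "\<lambda>_. std_gauss"]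
    by (simp cong: measurable_cong_sets)
  then show ?thesis
    unfolding cross_sum_def using assms
    by (intro borel_measurable_add borel_measurable_sum) auto
qed

text \<open>
  Flipping the signs of the couplings that enter the local fields of a set \<open>U\<close> of sites outside \<open>T\<close>
  preserves the measure and flips exactly these fields, so the \<open>2 ^ (N - card T)\<close> sign patterns are
  disjoint events of equal probability.
\<close>

lemma prob_cross_sums_pos:
  assumes T: "T \<subseteq> {1..N}"
  shows "measure (gauss ({1..N} \<times> {1..N})) {x \<in> space (gauss ({1..N} \<times> {1..N})). \<forall>i\<in>{1..N} - T. 0 < cross_sum x T i}
    \<le> (1 / 2) ^ (N - card T)"
proof -
  let ?I = "{1..N} \<times> {1..N}" and ?V = "{1..N} - T"
  let ?G = "gauss ?I"
  interpret G: prob_space ?G by (rule prob_space_gauss)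
  define E where "E U = {x \<in> space ?G. \<forall>i\<in>?V. 0 < (if i \<in> U then -1 else 1) * cross_sum x T i}" for U
  have E: "E U \<in> sets ?G" for U
    unfolding E_def
    by (intro sets.sets_Collect_finite_All borel_measurable_less borel_measurable_const
        borel_measurable_times measurable_cross_sum[OF T]) auto
  have eq: "measure ?G (E U) = measure ?G (E {})" if U: "U \<in> Pow ?V" for U
  proof -
    let ?F = "\<lambda>x. \<lambda>p\<in>?I. flip_sign T U p * x p"
    have m: "?F \<in> measurable ?G ?G" unfolding gauss_def by measurable
    have "measure ?G (E {}) = measure (distr ?G ?G ?F) (E {})"
      by (subst gauss_flip) (auto simp: flip_sign_def)
    also have "\<dots> = measure ?G (?F -` E {} \<inter> space ?G)"
      using m by (intro measure_distr E)
    also have "?F -` E {} \<inter> space ?G = E U"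
    proof -
      have "?F x \<in> E {} \<longleftrightarrow> x \<in> E U" if "x \<in> space ?G" for x
      proof -
        have "?F x \<in> space ?G" using that measurable_space[OF m] by blast
        moreover have "cross_sum (?F x) T i = (if i \<in> U then -1 else 1) * cross_sum x T i" if "i \<in> ?V" for i
          using T U that by (intro cross_sum_flip) auto
        ultimately show ?thesis using that unfolding E_def by auto
      qed
      then show ?thesis unfolding E_def by blast
    qed
    finally show ?thesis by simp
  qed
  have "disjoint_family_on E (Pow ?V)"
    unfolding disjoint_family_on_def
  proof (intro ballI impI)
    fix U U' assume U: "U \<in> Pow ?V" "U' \<in> Pow ?V" "U \<noteq> U'"
    then obtain i where i: "i \<in> ?V" "(i \<in> U) \<noteq> (i \<in> U')" by blast
    have False if "x \<in> E U" "x \<in> E U'" for x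
    proof -
      have "0 < (if i \<in> U then -1 else 1) * cross_sum x T i" "0 < (if i \<in> U' then -1 else 1) * cross_sum x T i"
        using that i(1) unfolding E_def by blast+
      then show False using i(2) by (auto split: if_splits)
    qed
    then show "E U \<inter> E U' = {}" by blast
  qed
  then have "measure ?G (\<Union>U\<in>Pow ?V. E U) = (\<Sum>U\<in>Pow ?V. measure ?G (E U))"
    using E by (intro G.finite_measure_finite_Union) auto
  also have "\<dots> = (\<Sum>U\<in>Pow ?V. measure ?G (E {}))"
    by (intro sum.cong refl eq)
  also have "\<dots> = 2 ^ card ?V * measure ?G (E {})"
    by (simp add: card_Pow)
  finally have "2 ^ card ?V * measure ?G (E {}) \<le> 1"
    using G.prob_le_1[of "\<Union>U\<in>Pow ?V. E U"] by simp
  moreover have "card ?V = N - card T"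
    using T by (simp add: card_Diff_subset finite_subset)
  ultimately have "measure ?G (E {}) \<le> (1 / 2) ^ (N - card T)"
    by (simp add: power_divide field_simps)
  then show ?thesis unfolding E_def by simp
qed

lemma sum_small_subsets:
  assumes N: "N \<ge> 1"
  shows "(\<Sum>T | T \<subseteq> {1..N} \<and> 6 * card T < N. (1 / 2) ^ (N - card T)) \<le> (9 / 10 :: real)"
proof -
  define r where "r = sqrt (2 :: real)"
  \<comment> \<open>The bound 1.44 is tailored to the end of the proof: 1.44 times 5/8 is exactly
    9/10.\<close>
  have r: "1 \<le> r" "r \<le> 144 / 100" "r\<^sup>2 = 2"
    unfolding r_def by (simp, rule real_le_lsqrt, auto simp: power2_eq_square)
  have r6: "r ^ 6 = 8" using arg_cong[OF r(3), of "\<lambda>u. u ^ 3"] by (simp flip: power_mult)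
  have "(\<Sum>T | T \<subseteq> {1..N} \<and> 6 * card T < N. (1 / 2) ^ (N - card T))
      \<le> (\<Sum>T | T \<subseteq> {1..N} \<and> 6 * card T < N. (r / 2) ^ N * (1 / 4) ^ card T)"
  proof (rule sum_mono)
    fix T assume T: "T \<in> {T. T \<subseteq> {1..N} \<and> 6 * card T < N}"
    have "8 ^ card T = r ^ (6 * card T)" by (simp add: power_mult r6)
    also have "\<dots> \<le> r ^ N" using T r by (intro power_increasing) auto
    finally have 8: "8 ^ card T \<le> r ^ N" .
    have cT: "card T \<le> N" using T by auto
    have "(1 / 2 :: real) ^ (N - card T) = (1 / 2) ^ N * (2 ^ card T)"
      using cT by (simp add: power_diff power_divide)
    also have "\<dots> = (1 / 2) ^ N * (8 ^ card T * (1 / 4) ^ card T)"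
      by (simp flip: power_mult_distrib)
    also have "\<dots> \<le> (1 / 2) ^ N * (r ^ N * (1 / 4) ^ card T)"
      using 8 by (intro mult_left_mono mult_right_mono) auto
    finally show "(1 / 2) ^ (N - card T) \<le> (r / 2) ^ N * (1 / 4) ^ card T"
      by (simp add: power_divide)
  qed
  also have "\<dots> \<le> (\<Sum>T\<in>Pow {1..N}. (r / 2) ^ N * (1 / 4) ^ card T)"
    using r by (intro sum_mono2) auto
  \<comment> \<open>Expanding the product over the sites chooses \<open>1 / 4\<close> on a subset
    \<open>T\<close> and 1 elsewhere.\<close>
  also have "\<dots> = (r / 2) ^ N * (\<Prod>i\<in>{1..N}. 1 / 4 + 1)"
    by (subst prod_add) (auto simp: sum_distrib_left)
  also have "\<dots> = (r * 5 / 8) ^ N"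
    by (simp add: power_mult_distrib[symmetric])
  also have "\<dots> \<le> (9 / 10) ^ N" using r by (intro power_mono) auto
  also have "\<dots> \<le> (9 / 10) ^ 1" using N by (intro power_decreasing) auto
  finally show ?thesis by simp
qed

section \<open>The ground energy\<close>

text \<open>The division by \<open>N\<close> instead of \<open>sqrt N\<close> encodes the rescaled
  energy \<open>H / sqrt N\<close>: the \<open>N * N\<close> entries of size at most
  \<open>1 / N\<close> have total norm at most 1.\<close>

definition subset_weight :: "nat \<Rightarrow> nat set \<Rightarrow> nat \<times> nat \<Rightarrow> real" where
  "subset_weight N T = (\<lambda>(i, j). indicator T i * indicator T j / real N)"

lemma sum_subset_indicator:
  fixes g :: "nat \<Rightarrow> nat \<Rightarrow> real"
  assumes "T \<subseteq> {1..N}"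
  shows "(\<Sum>i\<in>{1..N}. \<Sum>j\<in>{1..N}. indicator T i * indicator T j * g i j) = (\<Sum>i\<in>T. \<Sum>j\<in>T. g i j)"
proof -
  have "(\<Sum>j\<in>{1..N}. indicator T j * h j) = (\<Sum>j\<in>T. h j)" for h :: "nat \<Rightarrow> real"
    using assms by (intro sum.mono_neutral_cong_right) auto
  then show ?thesis
    by (simp add: mult.assoc flip: sum_distrib_left)
qed

lemma gauss_min_subset_weight:
  assumes N: "N \<ge> 1"
  shows "gauss_min ({1..N} \<times> {1..N}) (subset_weight N ` Pow {1..N})"
proof
  fix a assume "a \<in> subset_weight N ` Pow {1..N}"
  then obtain T where a: "a = subset_weight N T" by auto
  have "(\<Sum>p\<in>{1..N} \<times> {1..N}. (a p)\<^sup>2) \<le> (\<Sum>p\<in>{1..N} \<times> {1..N}. 1 / (real N)\<^sup>2)"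
    unfolding a subset_weight_def by (intro sum_mono) (auto simp: power_divide divide_right_mono indicator_def)
  also have "\<dots> = 1" using N by (simp add: power2_eq_square)
  finally show "(\<Sum>p\<in>{1..N} \<times> {1..N}. (a p)\<^sup>2) \<le> 1" .
qed auto

context
  fixes N :: nat
  assumes N: "N \<ge> 1"
begin

interpretation L: gauss_min "{1..N} \<times> {1..N}" "subset_weight N ` Pow {1..N}"
  by (rule gauss_min_subset_weight[OF N])

lemma lin_subset_weight:
  assumes "T \<subseteq> {1..N}"
  shows "L.lin (subset_weight N T) x = block_sum x T / real N"
proof -
  have "L.lin (subset_weight N T) x = (\<Sum>i\<in>{1..N}. \<Sum>j\<in>{1..N}. indicator T i * indicator T j * x (i, j)) / real N"
    unfolding L.lin_def subset_weight_def
    by (simp add: sum.cartesian_product sum_divide_distrib case_prod_unfold)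
  then show ?thesis
    unfolding sum_subset_indicator[OF assms] block_sum_def .
qed

text \<open>The shift lowers the rescaled energy of a set \<open>T\<close> by the square of
  \<open>card T / N\<close>, at least 1/36 when \<open>T\<close> has \<open>N / 6\<close> or more
  sites. Hence outside \<open>A\<close> every minimizer is small, and such points are covered by
  events \<open>B T\<close> of total probability at most 9/10.\<close>

lemma lo_drop:
  "1 / 10 \<le> measure (gauss ({1..N} \<times> {1..N}))
     {x \<in> space (gauss ({1..N} \<times> {1..N})).
       L.lo (\<lambda>p\<in>{1..N} \<times> {1..N}. x p + - 1 / real N) \<le> L.lo x - 1 / 36}"
proof -
  let ?I = "{1..N} \<times> {1..N}"
  let ?s = "\<lambda>x. \<lambda>p\<in>?I. x p + - 1 / real N"
  let ?small = "{T. T \<subseteq> {1..N} \<and> 6 * card T < N}"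
  define A where "A = {x \<in> space (gauss ?I). L.lo (?s x) \<le> L.lo x - 1 / 36}"
  define B where "B T = {x \<in> space (gauss ?I). \<forall>i\<in>{1..N} - T. 0 < cross_sum x T i}" for T
  have [measurable]: "?s \<in> measurable (gauss ?I) (gauss ?I)"
    unfolding gauss_def by measurable
  have A: "A \<in> sets (gauss ?I)" unfolding A_def by measurable
  have B: "B T \<in> sets (gauss ?I)" if "T \<in> ?small" for T
    unfolding B_def using that
    by (intro sets.sets_Collect_finite_All borel_measurable_less borel_measurable_const measurable_cross_sum) auto
  have fin: "finite ?small" by (rule finite_subset[of _ "Pow {1..N}"]) auto
  have "space (gauss ?I) - A \<subseteq> (\<Union>T\<in>?small. B T)"
  proof
    fix x assume x: "x \<in> space (gauss ?I) - A"
    then have xs: "x \<in> space (gauss ?I)" by simp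
    have "\<exists>T\<subseteq>{1..N}. 6 * card T < N \<and> (\<forall>i\<in>{1..N} - T. 0 < cross_sum x T i)"
    \<comment> \<open>Suppose that some minimizer at \<open>x\<close> occupies at least
      \<open>N / 6\<close> sites; then \<open>x\<close> would lie in \<open>A\<close>.\<close>
    proof (rule small_minimizer_cross_sums, rule ccontr)
      fix T assume T: "T \<subseteq> {1..N}" and min: "\<And>T'. T' \<subseteq> {1..N} \<Longrightarrow> block_sum x T \<le> block_sum x T'"
        and large: "\<not> 6 * card T < N"
      have "L.lo (?s x) \<le> L.lin (subset_weight N T) (?s x)"
        using T by (intro L.lo_le) auto
      also have "\<dots> = block_sum (?s x) T / real N"
        by (rule lin_subset_weight[OF T])
      also have "block_sum (?s x) T = (\<Sum>i\<in>T. \<Sum>j\<in>T. x (i, j) - 1 / real N)"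
        unfolding block_sum_def using T by (intro sum.cong) auto
      also have "\<dots> = block_sum x T - (real (card T))\<^sup>2 / real N"
        by (simp add: block_sum_def sum_subtractf power2_eq_square)
      also have "(block_sum x T - (real (card T))\<^sup>2 / real N) / real N
          = block_sum x T / real N - (real (card T) / real N)\<^sup>2"
        by (simp add: diff_divide_distrib power2_eq_square)
      finally have "L.lo (?s x) \<le> block_sum x T / real N - (real (card T) / real N)\<^sup>2" .
      moreover have "block_sum x T / real N \<le> L.lo x"
      proof -
        obtain T' where T': "T' \<subseteq> {1..N}" "L.lo x = L.lin (subset_weight N T') x"
          using L.lo_attained by blast
        have "block_sum x T / real N \<le> block_sum x T' / real N"
          using min[OF T'(1)] by (rule divide_right_mono) simp
        then show ?thesis unfolding T'(2) lin_subset_weight[OF T'(1)] .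
      qed
      moreover have "(1 / 6)\<^sup>2 \<le> (real (card T) / real N)\<^sup>2"
        using large N by (intro power_mono) (auto simp: field_simps)
      moreover have "(1 / 6)\<^sup>2 = (1 / 36 :: real)" by (simp add: power_divide)
      ultimately have "L.lo (?s x) \<le> L.lo x - 1 / 36" by linarith
      then show False using x by (simp add: A_def)
    qed
    then obtain T where "T \<in> ?small" "\<forall>i\<in>{1..N} - T. 0 < cross_sum x T i" by blast
    then show "x \<in> (\<Union>T\<in>?small. B T)"
      using xs by (intro UN_I[of T]) (simp_all add: B_def)
  qed
  then have "L.G.prob (space (gauss ?I) - A) \<le> L.G.prob (\<Union>T\<in>?small. B T)"
    using fin B by (intro L.G.finite_measure_mono sets.finite_UN) auto
  also have "\<dots> \<le> (\<Sum>T\<in>?small. L.G.prob (B T))"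
    using fin B by (intro measure_UNION_le) auto
  also have "\<dots> \<le> (\<Sum>T\<in>?small. (1 / 2) ^ (N - card T))"
    unfolding B_def by (intro sum_mono prob_cross_sums_pos) auto
  also have "\<dots> \<le> 9 / 10" by (rule sum_small_subsets[OF N])
  finally have "1 / 10 \<le> L.G.prob A"
    using L.G.prob_compl[OF A] by linarith
  then show ?thesis unfolding A_def .
qed

text \<open>Origin of the constants: \<open>lo_drop\<close> gives \<open>p = 1 / 10\<close> and
  \<open>d = 1 / 36\<close>, so \<open>dev_spread\<close> yields probability
  \<open>p\<^sup>2 / 14 = 1 / 1400\<close> at level \<open>d / 3 = 1 / 108\<close>. The absolute
  mean is thus at least 1/151200, which is \<open>2 * m\<close>.\<close>

lemma dev_gaussian_tail:
  fixes m \<kappa> :: real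
  defines "m \<equiv> 1 / 302400" and "\<kappa> \<equiv> (m\<^sup>2 / 72)\<^sup>2 / 8"
  assumes t: "0 < t"
  shows "measure (gauss ({1..N} \<times> {1..N})) {x \<in> space (gauss ({1..N} \<times> {1..N})). t < \<bar>L.dev x\<bar>}
    \<le> exp (- min (1 / 16) (min (\<kappa> / m) (\<kappa> * m / 16)) * t\<^sup>2)"
proof -
  let ?I = "{1..N} \<times> {1..N}"
  have "(\<Sum>p\<in>?I. (- 1 / real N)\<^sup>2) \<le> 1"
    using N by (simp add: power2_eq_square)
  from L.dev_spread[OF this _ _ _ lo_drop]
  have "1 / 1400 \<le> L.G.prob {x \<in> space (gauss ?I). 1 / 108 \<le> \<bar>L.dev x\<bar>}"
    by (simp add: power2_eq_square)
  from L.dev_abs_mean[OF _ this]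
  have m: "0 < m" "2 * m \<le> (\<integral>x. \<bar>L.dev x\<bar> \<partial>gauss ?I)"
    by (simp_all add: m_def)
  show ?thesis
  proof (rule gaussian_tail_without_prefactor[OF m(1) _ _ _ _ t])
    show "0 < \<kappa>" using m by (simp add: \<kappa>_def)
    show "L.G.prob {x \<in> space (gauss ?I). t < \<bar>L.dev x\<bar>} \<le> L.G.prob {x \<in> space (gauss ?I). s < \<bar>L.dev x\<bar>}"
      if "s \<le> t" for s t
      using that by (intro L.G.finite_measure_mono, force, measurable)
    show "L.G.prob {x \<in> space (gauss ?I). t < \<bar>L.dev x\<bar>} \<le> 2 * exp (- t\<^sup>2 / 8)" if "0 < t" for t
      by (rule L.dev_tail[OF that])
    show "L.G.prob {x \<in> space (gauss ?I). t < \<bar>L.dev x\<bar>} \<le> 1 - \<kappa> * t" if "0 < t" "t \<le> m" for t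
      unfolding \<kappa>_def by (rule L.dev_small_ball[OF m that])
  qed
qed

lemma ground_energy_eq_lo:
  "ground_energy N J \<omega> = sqrt (real N) * L.lo (\<lambda>p\<in>{1..N} \<times> {1..N}. J (fst p) (snd p) \<omega>)"
proof -
  let ?x = "\<lambda>p\<in>{1..N} \<times> {1..N}. J (fst p) (snd p) \<omega>"
  have "configs N = (\<lambda>T. \<lambda>i\<in>{1..N}. indicator T i) ` Pow {1..N}"
  proof (intro equalityI subsetI)
    fix \<eta> assume \<eta>: "\<eta> \<in> configs N"
    then have "\<eta> = (\<lambda>i\<in>{1..N}. indicator {i\<in>{1..N}. \<eta> i = 1} i)"
      unfolding configs_def by (intro ext) (auto simp: PiE_iff extensional_def indicator_def)
    then show "\<eta> \<in> (\<lambda>T. \<lambda>i\<in>{1..N}. indicator T i) ` Pow {1..N}" by blast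
  qed (auto simp: configs_def indicator_def)
  moreover have "hamiltonian N (\<lambda>i j. J i j \<omega>) (\<lambda>i\<in>{1..N}. indicator T i)
      = sqrt (real N) * L.lin (subset_weight N T) ?x" if T: "T \<subseteq> {1..N}" for T
  proof -
    have "(\<Sum>i=1..N. \<Sum>j=1..N. J i j \<omega> * (\<lambda>i\<in>{1..N}. indicator T i) i * (\<lambda>i\<in>{1..N}. indicator T i) j)
        = (\<Sum>i\<in>{1..N}. \<Sum>j\<in>{1..N}. indicator T i * indicator T j * ?x (i, j))"
      by (intro sum.cong) auto
    also have "\<dots> = block_sum ?x T"
      unfolding block_sum_def by (rule sum_subset_indicator[OF T])
    finally have s: "(\<Sum>i=1..N. \<Sum>j=1..N. J i j \<omega> * (\<lambda>i\<in>{1..N}. indicator T i) i * (\<lambda>i\<in>{1..N}. indicator T i) j)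
        = block_sum ?x T" .
    have "1 / sqrt (real N) = sqrt (real N) / real N"
      by (simp add: sqrt_divide_self_eq inverse_eq_divide)
    then show ?thesis
      unfolding hamiltonian_def lin_subset_weight[OF T] s by simp
  qed
  ultimately have "hamiltonian N (\<lambda>i j. J i j \<omega>) ` configs N
      = (\<lambda>y. sqrt (real N) * y) ` (\<lambda>a. L.lin a ?x) ` subset_weight N ` Pow {1..N}"
    by (simp add: image_image)
  moreover have "mono (\<lambda>y. sqrt (real N) * y)"
    by (intro monoI mult_left_mono) auto
  ultimately show ?thesis
    unfolding ground_energy_def L.lo_def
    by (subst mono_Min_commute[where f = "\<lambda>y. sqrt (real N) * y"]) auto
qed

section \<open>Transfer from the canonical product measure to arbitrary couplings\<close>

lemma distr_couplings:
  assumes "iid_std_gaussians N \<Omega> J"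
  shows "(\<lambda>\<omega>. \<lambda>p\<in>{1..N} \<times> {1..N}. J (fst p) (snd p) \<omega>) \<in> measurable \<Omega> (gauss ({1..N} \<times> {1..N}))"
    and "distr \<Omega> (gauss ({1..N} \<times> {1..N})) (\<lambda>\<omega>. \<lambda>p\<in>{1..N} \<times> {1..N}. J (fst p) (snd p) \<omega>)
      = gauss ({1..N} \<times> {1..N})"
proof -
  let ?I = "{1..N} \<times> {1..N}" and ?X = "\<lambda>p. J (fst p) (snd p)"
  interpret \<Omega>: prob_space \<Omega> using assms by (simp add: iid_std_gaussians_def)
  have ind: "\<Omega>.indep_vars (\<lambda>_. borel) ?X ?I"
    using assms by (simp add: iid_std_gaussians_def case_prod_unfold)
  have d: "distributed \<Omega> lborel (?X p) std_normal_density" if "p \<in> ?I" for p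
    using assms that by (auto simp: iid_std_gaussians_def)
  have rv: "?X p \<in> borel_measurable \<Omega>" if "p \<in> ?I" for p
    using distributed_measurable[OF d[OF that]] by simp
  then have "(\<lambda>\<omega>. \<lambda>p\<in>?I. ?X p \<omega>) \<in> measurable \<Omega> (PiM ?I (\<lambda>_. borel))"
    by (intro measurable_restrict)
  then show "(\<lambda>\<omega>. \<lambda>p\<in>?I. ?X p \<omega>) \<in> measurable \<Omega> (gauss ?I)"
    by (simp cong: measurable_cong_sets)
  have "distr \<Omega> (gauss ?I) (\<lambda>\<omega>. \<lambda>p\<in>?I. ?X p \<omega>) = distr \<Omega> (PiM ?I (\<lambda>_. borel)) (\<lambda>\<omega>. \<lambda>p\<in>?I. ?X p \<omega>)"
    by (intro distr_cong) auto
  also have "\<dots> = PiM ?I (\<lambda>p. distr \<Omega> borel (?X p))"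
    using ind rv N by (subst (asm) \<Omega>.indep_vars_iff_distr_eq_PiM') auto
  also have "\<dots> = gauss ?I"
    unfolding gauss_def
  proof (rule PiM_cong[OF refl])
    fix p assume "p \<in> ?I"
    have "distr \<Omega> borel (?X p) = distr \<Omega> lborel (?X p)" by (intro distr_cong) auto
    then show "distr \<Omega> borel (?X p) = std_gauss"
      using distributed_distr_eq_density[OF d[OF \<open>p \<in> ?I\<close>]] by (simp add: std_gauss_def)
  qed
  finally show "distr \<Omega> (gauss ?I) (\<lambda>\<omega>. \<lambda>p\<in>?I. ?X p \<omega>) = gauss ?I" .
qed

text \<open>Undoes the scaling: the ground energy is \<open>sqrt N\<close> times \<open>lo\<close>,
  so the level \<open>N * z\<close> for the former is \<open>sqrt N * z\<close> for the latter,
  whose square \<open>N * z\<^sup>2\<close> is the required exponent.\<close>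

lemma ground_deviation_tail:
  fixes m \<kappa> :: real
  defines "m \<equiv> 1 / 302400" and "\<kappa> \<equiv> (m\<^sup>2 / 72)\<^sup>2 / 8"
  assumes iid: "iid_std_gaussians N \<Omega> J" and z: "0 < z"
  shows "measure \<Omega> {\<omega> \<in> space \<Omega>. \<bar>ground_deviation N \<Omega> J \<omega>\<bar> > real N * z}
    \<le> exp (- min (1 / 16) (min (\<kappa> / m) (\<kappa> * m / 16)) * real N * z\<^sup>2)"
proof -
  let ?I = "{1..N} \<times> {1..N}"
  define X where "X = (\<lambda>\<omega>. \<lambda>p\<in>?I. J (fst p) (snd p) \<omega>)"
  note X = distr_couplings[OF iid, folded X_def]
  have e: "ground_energy N J = (\<lambda>\<omega>. sqrt (real N) * L.lo (X \<omega>))"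
    unfolding X_def by (intro ext ground_energy_eq_lo)
  have "integral\<^sup>L \<Omega> (\<lambda>\<omega>. L.lo (X \<omega>)) = integral\<^sup>L (distr \<Omega> (gauss ?I) X) L.lo"
    by (rule integral_distr[symmetric, OF X(1) L.measurable_lo])
  then have "integral\<^sup>L \<Omega> (ground_energy N J) = sqrt (real N) * integral\<^sup>L (gauss ?I) L.lo"
    unfolding e X(2) by simp
  then have dev: "ground_deviation N \<Omega> J \<omega> = sqrt (real N) * L.dev (X \<omega>)" for \<omega>
    unfolding ground_deviation_def e L.dev_def by (simp add: right_diff_distrib)
  let ?t = "sqrt (real N) * z"
  have scale: "real N * z < \<bar>sqrt (real N) * u\<bar> \<longleftrightarrow> ?t < \<bar>u\<bar>" for u
  proof -
    have a: "real N * z = sqrt (real N) * ?t"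
      by (simp add: mult.assoc[symmetric])
    have b: "\<bar>sqrt (real N) * u\<bar> = sqrt (real N) * \<bar>u\<bar>"
      by (simp add: abs_mult)
    show ?thesis
      unfolding a b by (rule mult_less_cancel_left_pos) (use N in simp)
  qed
  have "{\<omega> \<in> space \<Omega>. \<bar>ground_deviation N \<Omega> J \<omega>\<bar> > real N * z}
      = {\<omega> \<in> space \<Omega>. ?t < \<bar>L.dev (X \<omega>)\<bar>}"
    unfolding dev scale ..
  also have "\<dots> = X -` {x \<in> space (gauss ?I). ?t < \<bar>L.dev x\<bar>} \<inter> space \<Omega>"
    using measurable_space[OF X(1)] by blast
  finally have "measure \<Omega> {\<omega> \<in> space \<Omega>. \<bar>ground_deviation N \<Omega> J \<omega>\<bar> > real N * z}
      = measure \<Omega> (X -` {x \<in> space (gauss ?I). ?t < \<bar>L.dev x\<bar>} \<inter> space \<Omega>)"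
    by (rule arg_cong)
  also have "\<dots> = measure (distr \<Omega> (gauss ?I) X) {x \<in> space (gauss ?I). ?t < \<bar>L.dev x\<bar>}"
    by (rule measure_distr[symmetric, OF X(1)]) measurable
  also have "\<dots> = measure (gauss ?I) {x \<in> space (gauss ?I). ?t < \<bar>L.dev x\<bar>}"
    by (simp only: X(2))
  also have "\<dots> \<le> exp (- min (1 / 16) (min (\<kappa> / m) (\<kappa> * m / 16)) * ?t\<^sup>2)"
    unfolding m_def \<kappa>_def by (rule dev_gaussian_tail) (use N z in simp)
  also have "?t\<^sup>2 = real N * z\<^sup>2" by (simp add: power_mult_distrib)
  finally show ?thesis unfolding mult.assoc .
qed

end

theorem theorem2p1:
  shows "\<exists>C>0. \<forall>N\<ge>1. \<forall>(\<Omega> :: 'a measure) J. iid_std_gaussians N \<Omega> J \<longrightarrow>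
           (\<forall>z>0. measure \<Omega> {\<omega> \<in> space \<Omega>. \<bar>ground_deviation N \<Omega> J \<omega>\<bar> > real N * z}
                    \<le> exp (- C * real N * z\<^sup>2))"
proof -
  \<comment> \<open>The same values as in \<open>dev_gaussian_tail\<close>. None of them mentions
    \<open>N\<close>, so \<open>C\<close> can be fixed before \<open>N\<close>, the probability
    space and \<open>z\<close>.\<close>
  define m :: real where "m = 1 / 302400"
  define \<kappa> where "\<kappa> = (m\<^sup>2 / 72)\<^sup>2 / 8"
  define C where "C = min (1 / 16) (min (\<kappa> / m) (\<kappa> * m / 16))"
  have "0 < m" by (simp add: m_def)
  then have "0 < \<kappa>" by (simp add: \<kappa>_def)
  then have "0 < C" using \<open>0 < m\<close> by (simp add: C_def)
  then show ?thesis
  proof (intro exI[of _ C] conjI allI impI)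
    fix N :: nat and \<Omega> :: "'a measure" and J z
    assume "1 \<le> N" "iid_std_gaussians N \<Omega> J" "0 < (z :: real)"
    then show "measure \<Omega> {\<omega> \<in> space \<Omega>. \<bar>ground_deviation N \<Omega> J \<omega>\<bar> > real N * z} \<le> exp (- C * real N * z\<^sup>2)"
      unfolding C_def \<kappa>_def m_def by (rule ground_deviation_tail)
  qed
qed

end
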